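(* For any infinite ordinal $\alpha=\omega\beta+n$ (with $\beta$ an ordinal and $n<\omega$, which are uniquely determined by $\alpha$), $\zeta_\alpha=\omega^\beta\cdot(n+1)$ (ordinal arithmetic) and $\zeta_\alpha$ is realized.
   Context: A wellordered connected graph $(V,E,<)$ is a (nonempty, possibly infinite) connected undirected graph $(V,E)$ together with a wellordering $<$ of $V$; its order type is the order type of $(V,<)$. Deterministic graph search on $(V,E,<)$ defines sets $S_\alpha\subseteq V$ by transfinite recursion: $S_0=\emptyset$; $S_1=\{v_0\}$, where $v_0$ is the $<$-least element of $V$; for $\beta\ge 1$, $S_{\beta+1}$ is obtained from $S_\beta$ by adding the $<$-least element of $\{v\in V\setminus S_\beta:\exists w\in S_\beta\ E(w,v)\}$ if this set is nonempty, and $S_{\beta+1}=S_\beta$ otherwise; and $S_\alpha=\bigcup_{\beta<\alpha}S_\beta$ at limit $\alpha$. Every vertex eventually enters some $S_\alpha$. The algorithmic traversal is the wellordering $\prec$ of $V$ given by $v\prec w$ iff the least $\alpha$ with $v\in S_\alpha$ is less than the least $\alpha$ with $w\in S_\alpha$. For an ordinal $\alpha$, $\zeta_\alpha$ denotes the supremum of the order types of the algorithmic traversals $(V,\prec)$ over all wellordered connected graphs of order type $\alpha$. $\zeta_\alpha$ is realized if there is a wellordered connected graph of order type $\alpha$ whose algorithmic traversal has order type exactly $\zeta_\alpha$. *)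

(* HOL-Algebra.Free_Abelian_Groups is imported only because it brings along the HOL-Cardinals
   theory Wellorder_Constructions (zero/successor/limit recursion along a wellorder). *)
theory Defs
  imports "HOL-Algebra.Free_Abelian_Groups"
begin

unbundle cardinal_syntax

section \<open>Ordinal arithmetic\<close>

text \<open>
  As in the theories on wellorders of Isabelle/HOL, an ordinal is represented by a (reflexive)
  wellorder relation, and equality of ordinals is order isomorphism, \<open>=o\<close>. The ordinal
  \<open>\<omega>\<close> is \<^const>\<open>natLeq\<close> and the finite ordinal \<open>n\<close> is \<open>natLeq_on n\<close>.
\<close>

definition osum :: "'a rel \<Rightarrow> 'b rel \<Rightarrow> ('a + 'b) rel"  (infixr \<open>+o\<close> 70)
  where "r +o s =
    {(Inl a, Inl a') | a a'. (a, a') \<in> r} \<union>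
    {(Inr b, Inr b') | b b'. (b, b') \<in> s} \<union>
    {(Inl a, Inr b) | a b. a \<in> Field r \<and> b \<in> Field s}"

text \<open>\<open>r *o s\<close> is \<open>s\<close> many consecutive copies of \<open>r\<close>, so the second
  component is the significant one.\<close>

definition oprod :: "'a rel \<Rightarrow> 'b rel \<Rightarrow> ('a \<times> 'b) rel"  (infixr \<open>*o\<close> 80)
  where "r *o s =
    {((a, b), (a', b')). a \<in> Field r \<and> a' \<in> Field r \<and> (b, b') \<in> s \<and>
       (b = b' \<longrightarrow> (a, a') \<in> r)}"

text \<open>\<open>r ^o s\<close>: the functions from \<open>s\<close> to \<open>r\<close> which are zero at all but finitely
  many places, compared at the largest place where they differ.\<close>

definition oexp_carrier :: "'a rel \<Rightarrow> 'b rel \<Rightarrow> ('b \<Rightarrow> 'a) set"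
  where "oexp_carrier r s =
    {f \<in> Func (Field s) (Field r). finite {b \<in> Field s. f b \<noteq> wo_rel.zero r}}"

definition oexp :: "'a rel \<Rightarrow> 'b rel \<Rightarrow> ('b \<Rightarrow> 'a) rel"  (infixr \<open>^o\<close> 90)
  where "r ^o s =
    {(f, g). f \<in> oexp_carrier r s \<and> g \<in> oexp_carrier r s \<and>
       (f = g \<or>
        (\<exists>b \<in> Field s. f b \<noteq> g b \<and> (f b, g b) \<in> r \<and>
           (\<forall>b' \<in> aboveS s b. f b' = g b')))}"

text \<open>Leastness is tested only against ordinals on the carrier type of \<open>\<zeta>\<close>; this is no
  restriction, since every ordinal below \<open>\<zeta>\<close> is the type of an initial segment of \<open>\<zeta>\<close>.\<close>

definition is_ord_Sup :: "'a rel set \<Rightarrow> 'b rel \<Rightarrow> bool"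
  where "is_ord_Sup T \<zeta> \<longleftrightarrow>
    Well_order \<zeta> \<and> (\<forall>\<tau>\<in>T. \<tau> \<le>o \<zeta>) \<and>
    (\<forall>\<delta> :: 'b rel. Well_order \<delta> \<and> (\<forall>\<tau>\<in>T. \<tau> \<le>o \<delta>) \<longrightarrow> \<zeta> \<le>o \<delta>)"

section \<open>Deterministic graph search\<close>

locale wellordered_connected_graph =
  fixes V :: "'v set" and E :: "'v rel" and r :: "'v rel"
  assumes vertices_nonempty: "V \<noteq> {}"
    and edges: "E \<subseteq> V \<times> V"
    and undirected: "sym E"
    and loopfree: "irrefl E"
    and connected: "\<And>u v. u \<in> V \<Longrightarrow> v \<in> V \<Longrightarrow> (u, v) \<in> E\<^sup>*"
    and wellordered: "well_order_on V r"

definition search_step :: "'v set \<Rightarrow> 'v rel \<Rightarrow> 'v rel \<Rightarrow> 'v set \<Rightarrow> 'v set"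
  where "search_step V E r A =
    (let N = {v \<in> V - A. \<exists>w\<in>A. (w, v) \<in> E}
     in if N = {} then A else insert (wo_rel.minim r N) A)"

text \<open>
  The stages are indexed by the elements of a wellorder \<open>s\<close>, the element with predecessors of
  order type \<open>\<alpha>\<close> standing for the ordinal \<open>\<alpha>\<close>. The first successor stage is \<open>S\<^sub>1\<close>.
\<close>

definition search_stage :: "'i rel \<Rightarrow> 'v set \<Rightarrow> 'v rel \<Rightarrow> 'v rel \<Rightarrow> 'i \<Rightarrow> 'v set"
  where "search_stage s V E r =
    wo_rel.worecZSL s {}
      (\<lambda>\<beta> A. if \<beta> = wo_rel.zero s then {wo_rel.minim r V} else search_step V E r A)
      (\<lambda>S \<alpha>. \<Union>\<beta> \<in> underS s \<alpha>. S \<beta>)"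

context
  fixes s :: "'i rel" and V :: "'v set" and E r :: "'v rel"
  assumes s: "Well_order s"
begin

interpretation s: wo_rel s using s by (simp add: wo_rel_def)

private lemma adm: "s.adm_woL (\<lambda>S \<alpha>. \<Union>\<beta> \<in> underS s \<alpha>. S \<beta>)"
  by (auto simp: s.adm_woL_def)

lemma search_stage_zero: "search_stage s V E r (wo_rel.zero s) = {}"
  unfolding search_stage_def by (rule s.worecZSL_zero[OF adm])

lemma search_stage_one:
  "aboveS s (wo_rel.zero s) \<noteq> {} \<Longrightarrow>
   search_stage s V E r (wo_rel.succ s (wo_rel.zero s)) = {wo_rel.minim r V}"
  unfolding search_stage_def by (subst s.worecZSL_succ[OF adm]) auto

lemma search_stage_succ:
  "aboveS s \<beta> \<noteq> {} \<Longrightarrow> \<beta> \<noteq> wo_rel.zero s \<Longrightarrow>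
   search_stage s V E r (wo_rel.succ s \<beta>) = search_step V E r (search_stage s V E r \<beta>)"
  unfolding search_stage_def by (subst s.worecZSL_succ[OF adm]) auto

lemma search_stage_limit:
  "wo_rel.isLim s \<alpha> \<Longrightarrow> \<alpha> \<noteq> wo_rel.zero s \<Longrightarrow>
   search_stage s V E r \<alpha> = (\<Union>\<beta> \<in> underS s \<alpha>. search_stage s V E r \<beta>)"
  unfolding search_stage_def by (rule s.worecZSL_isLim[OF adm])

end

text \<open>
  Each stage strictly enlarges the previous one until all of \<open>V\<close> is reached, so every vertex
  enters at a stage whose index is smaller than the successor cardinal of the cardinality of \<open>V\<close>
  (for finite \<open>V\<close> with \<open>k\<close> elements, this cardinal is the ordinal \<open>k + 1\<close>, with elements
  \<open>0, \<dots>, k\<close>).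
\<close>

abbreviation search_index :: "'v set \<Rightarrow> 'v set rel"
  where "search_index V \<equiv> cardSuc |V|"

definition entry_stage :: "'v set \<Rightarrow> 'v rel \<Rightarrow> 'v rel \<Rightarrow> 'v \<Rightarrow> 'v set"
  where "entry_stage V E r v =
    wo_rel.minim (search_index V)
      {\<alpha> \<in> Field (search_index V). v \<in> search_stage (search_index V) V E r \<alpha>}"

text \<open>The reflexive closure of \<open>\<prec>\<close>, wellorders being reflexive here.\<close>

definition traversal :: "'v set \<Rightarrow> 'v rel \<Rightarrow> 'v rel \<Rightarrow> 'v rel"
  where "traversal V E r =
    {(v, w). v \<in> V \<and> w \<in> V \<and>
       (v = w \<or> (entry_stage V E r v, entry_stage V E r w) \<in> search_index V - Id)}"

section \<open>The ordinals \<open>\<zeta>\<^sub>\<alpha>\<close>\<close>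

text \<open>Every graph of order type \<open>\<alpha>\<close> is isomorphic to one with vertices in the carrier type
  of \<open>\<alpha>\<close>.\<close>

definition traversal_types :: "'a rel \<Rightarrow> 'a rel set"
  where "traversal_types \<alpha> =
    {traversal V E r | V E r. wellordered_connected_graph V E r \<and> r =o \<alpha>}"

text \<open>All members of a set of wellorders on the type \<open>'a\<close> are below the successor cardinal of
  the cardinality of \<open>'a\<close>, so the type \<open>'a set\<close> has room for the supremum.\<close>

lemma ord_Sup_exists:
  fixes T :: "'a rel set"
  assumes T: "\<And>\<tau>. \<tau> \<in> T \<Longrightarrow> Well_order \<tau>"
  shows "\<exists>\<zeta> :: 'a set rel. is_ord_Sup T \<zeta>"
proof -
  define B where "B = {\<delta> :: 'a set rel. Well_order \<delta> \<and> (\<forall>\<tau>\<in>T. \<tau> \<le>o \<delta>)}"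
  let ?k = "cardSuc |UNIV :: 'a set|"
  have k: "Card_order ?k" by (simp add: cardSuc_Card_order)
  have "\<tau> \<le>o ?k" if "\<tau> \<in> T" for \<tau>
  proof (rule ccontr)
    assume "\<not> \<tau> \<le>o ?k"
    then have "?k \<le>o \<tau>"
      using T[OF that] k card_order_on_well_order_on ordLeq_total by blast
    then have "|Field ?k| \<le>o |Field \<tau>|"
      by (rule card_of_mono2)
    moreover have "|Field \<tau>| \<le>o |UNIV :: 'a set|"
      by (simp add: card_of_mono1)
    ultimately have "?k \<le>o |UNIV :: 'a set|"
      using card_of_Field_ordIso[OF k] ordIso_ordLeq_trans ordIso_symmetric ordLeq_transitive
      by blast
    moreover have "|UNIV :: 'a set| <o ?k"
      by (simp add: cardSuc_greater)
    ultimately show False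
      using not_ordLess_ordLeq by blast
  qed
  then have "?k \<in> B"
    using k card_order_on_well_order_on by (auto simp: B_def)
  then obtain \<zeta> where "\<zeta> \<in> B" and least: "\<And>\<delta>. (\<delta>, \<zeta>) \<in> ordLess \<Longrightarrow> \<delta> \<notin> B"
    using wf_ordLess[unfolded wf_eq_minimal] by metis
  then have "is_ord_Sup T \<zeta>"
    unfolding is_ord_Sup_def B_def using not_ordLeq_iff_ordLess by fastforce
  then show ?thesis by blast
qed

definition zeta :: "'a rel \<Rightarrow> 'a set rel"
  where "zeta \<alpha> = (SOME \<zeta>. is_ord_Sup (traversal_types \<alpha>) \<zeta>)"

definition zeta_realized :: "'a rel \<Rightarrow> bool"
  where "zeta_realized \<alpha> \<longleftrightarrow> (\<exists>\<tau> \<in> traversal_types \<alpha>. \<tau> =o zeta \<alpha>)"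

end

theory Submission
  imports Defs "HOL-Library.Multiset"
begin


text \<open>Write \<open>\<prec>\<close> for the traversal order. When a vertex is visited, it is the least one among those
with a visited neighbour. So if \<open>u\<close> is a neighbour of \<open>x\<close> visited before \<open>x\<close>, then every vertex
visited after \<open>u\<close> and up to \<open>x\<close> was preferred to \<open>x\<close> or is \<open>x\<close>: it is \<open>\<le> x\<close> in the given order.
Passing from \<open>x\<close> to such a \<open>u\<close>, and so on, leads to the first vertex after finitely many steps.

Upper bound. Cut \<open>\<omega> \<cdot> \<beta> + n\<close> into \<open>\<beta>\<close> many blocks of type \<open>\<omega>\<close> and one top block of \<open>n\<close> vertices.
Send \<open>x\<close> to the function that counts, for each block, its vertices visited up to \<open>x\<close> which have not
been overtaken by a vertex of a higher block. By the descent just described only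
finitely many vertices are counted, so the counts form an element of \<open>\<omega>\<^sup>\<beta> \<cdot> (n + 1)\<close>. Between \<open>x\<close> and
a later \<open>x'\<close>, some block is the highest one visited: its count grows while the counts of all higher
blocks stay. So the map is strictly increasing (\<open>traversal_ordLeq\<close>).

Lower bound. Conversely, a tree whose vertices carry a well-order \<open>\<theta>\<close> is traversed in the order
\<open>\<theta>\<close> as soon as all elements strictly between the parent of \<open>y\<close> and \<open>y\<close> are placed at smaller
vertices than \<open>y\<close>; vertices not needed are attached to the root as leaves, which disturb nothing
(\<open>traversal_of_parents\<close>). In \<open>\<theta> = \<omega>\<^sup>\<beta> \<cdot> (n + 1)\<close> the parent of a nonzero function is found by
lowering its value at its least nonzero place \<open>b\<close> by one. Everything in between has its least
nonzero place below \<open>b\<close> and agrees with the function above \<open>b\<close> (\<open>between_dec\<close>). What is left is to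
place the functions injectively in \<open>\<omega> \<cdot> \<beta>\<close>. If \<open>\<beta>\<close> is countable, a function can go to the block of
its least nonzero place. In general there are more functions than fit in that block, and larger pieces
are used: maximal intervals in which any two positions have fewer than \<open>\<kappa>\<close> positions between
them, where \<open>\<kappa>\<close> is the cardinality of what follows. Such a segment has \<open>\<kappa>\<close> elements and all its proper
initial segments have fewer. The functions with least nonzero place in the segment and with
prescribed values above the segment form a chain with the same smallness property, so they can be placed increasingly in any
part of the segment of size \<open>\<kappa>\<close>; as \<open>\<kappa> \<cdot> \<kappa> = \<kappa>\<close>, different chains get disjoint parts (\<open>placement\<close>).

The decomposition \<open>\<alpha> = \<omega> \<cdot> \<beta> + n\<close> is read off \<open>\<alpha>\<close>: the number \<open>n\<close> counts the elements with only
finitely many elements above them, and \<open>\<beta>\<close> is the order type of the non-successors among the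
others.\<close>

section \<open>Well-orders and their strict parts\<close>

definition below :: "'a rel \<Rightarrow> 'a \<Rightarrow> 'a \<Rightarrow> bool"
  where "below r x y \<longleftrightarrow> (x, y) \<in> r \<and> x \<noteq> y"

lemma below_irrefl [simp]: "\<not> below r x x"
  by (simp add: below_def)

lemma below_in: "below r x y \<Longrightarrow> (x, y) \<in> r"
  by (simp add: below_def)

lemma below_Field: "below r x y \<Longrightarrow> x \<in> Field r \<and> y \<in> Field r"
  by (auto simp: below_def Field_def)

context
  fixes r :: "'a rel"
  assumes r: "Well_order r"
begin

lemma wo_refl: "x \<in> Field r \<Longrightarrow> (x, x) \<in> r"
  using r by (simp add: order_on_defs refl_on_def)

lemma wo_trans: "(x, y) \<in> r \<Longrightarrow> (y, z) \<in> r \<Longrightarrow> (x, z) \<in> r"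
  using r by (meson order_on_defs transD)

lemma wo_antisym: "(x, y) \<in> r \<Longrightarrow> (y, x) \<in> r \<Longrightarrow> x = y"
  using r by (meson order_on_defs antisymD)

lemma below_le_trans: "below r x y \<Longrightarrow> (y, z) \<in> r \<Longrightarrow> below r x z"
  unfolding below_def using wo_trans wo_antisym by blast

lemma le_below_trans: "(x, y) \<in> r \<Longrightarrow> below r y z \<Longrightarrow> below r x z"
  unfolding below_def using wo_trans wo_antisym by blast

lemma below_trans: "below r x y \<Longrightarrow> below r y z \<Longrightarrow> below r x z"
  using below_le_trans below_in by metis

lemma below_not_le: "below r x y \<Longrightarrow> (y, x) \<notin> r"
  unfolding below_def using wo_antisym by blast

lemma not_below_iff: "x \<in> Field r \<Longrightarrow> y \<in> Field r \<Longrightarrow> \<not> below r x y \<longleftrightarrow> (y, x) \<in> r"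
  using r unfolding below_def order_on_defs total_on_def refl_on_def antisym_def by metis

lemma below_total: "x \<in> Field r \<Longrightarrow> y \<in> Field r \<Longrightarrow> below r x y \<or> x = y \<or> below r y x"
  using not_below_iff below_def by metis

lemma wo_least:
  assumes "A \<subseteq> Field r" "A \<noteq> {}"
  shows "\<exists>m\<in>A. \<forall>a\<in>A. (m, a) \<in> r"
  using wo_rel.minim_in[of r A] wo_rel.minim_least[of r A] assms r by (auto simp: wo_rel_def)

lemma wo_greatest:
  assumes "finite A" "A \<noteq> {}" "A \<subseteq> Field r"
  shows "\<exists>m\<in>A. \<forall>a\<in>A. (a, m) \<in> r"
  using assms
proof (induction A rule: finite_ne_induct)
  case (singleton x)
  then show ?case using wo_refl by simp
next
  case (insert x F)
  then obtain m where m: "m \<in> F" "\<forall>a\<in>F. (a, m) \<in> r" by auto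
  show ?case
  proof (cases "(x, m) \<in> r")
    case False
    then have "below r m x" using not_below_iff m insert.prems by blast
    then show ?thesis using m wo_refl insert.prems below_in le_below_trans by (metis insert_iff insert_subset)
  qed (use m in auto)
qed

lemma wf_below: "wf {(x, y). below r x y}"
proof -
  have "{(x, y). below r x y} = r - Id" by (auto simp: below_def)
  then show ?thesis using r by (simp add: well_order_on_def)
qed

lemma below_induct:
  assumes "\<And>x. (\<And>y. below r y x \<Longrightarrow> P y) \<Longrightarrow> P x"
  shows "P x"
  using wf_below assms by (induction x rule: wf_induct_rule) auto

end

lemma well_order_on_strictI:
  assumes irrefl: "\<And>x. x \<in> A \<Longrightarrow> \<not> P x x"
    and trans: "\<And>x y z. x \<in> A \<Longrightarrow> y \<in> A \<Longrightarrow> z \<in> A \<Longrightarrow> P x y \<Longrightarrow> P y z \<Longrightarrow> P x z"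
    and total: "\<And>x y. x \<in> A \<Longrightarrow> y \<in> A \<Longrightarrow> P x y \<or> x = y \<or> P y x"
    and wf: "wf {(x, y). x \<in> A \<and> y \<in> A \<and> P x y}"
  shows "well_order_on A {(x, y). x \<in> A \<and> y \<in> A \<and> (x = y \<or> P x y)}" (is "well_order_on A ?r")
proof -
  have "trans ?r" unfolding trans_def using trans by blast
  moreover have "antisym ?r" unfolding antisym_def using trans irrefl by blast
  moreover have "total_on A ?r" unfolding total_on_def using total by blast
  moreover have "wf (?r - Id)" by (rule wf_subset[OF wf]) auto
  ultimately show ?thesis unfolding order_on_defs refl_on_def by auto
qed

lemma well_order_on_Field: "well_order_on A r \<Longrightarrow> Field r = A \<and> Well_order r"
  using well_order_on_Well_order by blast

text \<open>A strictly increasing self-map of a well-order never moves a point down: the least point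
  moved down would be moved down again, to a smaller point that is moved down. Hence no well-order
  maps strictly increasingly into a proper initial segment of itself.\<close>

lemma strict_mono_imp_ordLeq:
  assumes r: "Well_order r" and s: "Well_order s"
    and f_in: "\<And>x. x \<in> Field r \<Longrightarrow> f x \<in> Field s"
    and mono: "\<And>x y. below r x y \<Longrightarrow> below s (f x) (f y)"
  shows "r \<le>o s"
proof (rule ccontr)
  assume "\<not> r \<le>o s"
  then have "s <o r" using r s not_ordLeq_iff_ordLess by blast
  then obtain g where g: "embedS s r g" unfolding ordLess_def by blast
  then have emb: "embed s r g" and "g ` Field s \<noteq> Field r"
    using s embed_bothWays_Field_bij_betw by (auto simp: embedS_def bij_betw_def embed_inj_on)
  moreover have "g ` Field s \<subseteq> Field r"
    using embed_Field[OF emb] .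
  ultimately obtain a where a: "a \<in> Field r" "a \<notin> g ` Field s" by blast
  have of: "wo_rel.ofilter r (g ` Field s)"
    using embed_Field_ofilter[OF s r emb] .
  have h: "below r (g x) (g y)" if "below s x y" for x y
    using that embed_compat[OF emb] embed_inj_on[OF s emb] below_Field[OF that]
    unfolding below_def compat_def inj_on_def by blast
  have down: "below r (g x) a" if "x \<in> Field s" for x
  proof (rule ccontr)
    assume "\<not> below r (g x) a"
    then have "(a, g x) \<in> r"
      using not_below_iff[OF r] a(1) embed_in_Field[OF emb that] by blast
    then have "a \<in> g ` Field s"
      using of that r unfolding wo_rel.ofilter_def[unfolded wo_rel_def, OF r] under_def by blast
    then show False using a by blast
  qed
  have "\<not> below r (g (f x)) x" for x
  proof (induction x rule: below_induct[OF r])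
    case (1 x)
    show ?case using 1[of "g (f x)"] h mono by blast
  qed
  then show False using down f_in a by blast
qed

lemma ordLeq_strict_monoE:
  assumes "r \<le>o s"
  obtains f where "\<And>x. x \<in> Field r \<Longrightarrow> f x \<in> Field s" "\<And>x y. below r x y \<Longrightarrow> below s (f x) (f y)"
proof -
  from assms obtain f where r: "Well_order r" and f: "embed r s f" unfolding ordLeq_def by blast
  have "below s (f x) (f y)" if "below r x y" for x y
    using that embed_compat[OF f] embed_inj_on[OF r f] below_Field[OF that]
    unfolding below_def compat_def inj_on_def by blast
  then show ?thesis using that embed_in_Field[OF f] by blast
qed

lemma strict_bij_imp_ordIso:
  assumes r: "Well_order r" and s: "Well_order s"
    and f: "bij_betw f (Field r) (Field s)"
    and mono: "\<And>x y. below r x y \<Longrightarrow> below s (f x) (f y)"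
  shows "r =o s"
proof -
  have "compat r s f"
    unfolding compat_def using mono wo_refl[OF s] f
    by (metis Field_def UnI1 Domain.DomainI below_def bij_betwE)
  then have "BNF_Wellorder_Embedding.iso r s f" using iso_iff3[OF r s] f by blast
  then show ?thesis using r s unfolding ordIso_def by blast
qed

lemma ordIso_bij:
  assumes "r =o s"
  shows "\<exists>g. bij_betw g (Field r) (Field s) \<and>
    (\<forall>x\<in>Field r. \<forall>y\<in>Field r. (g x, g y) \<in> s \<longleftrightarrow> (x, y) \<in> r) \<and>
    (\<forall>x\<in>Field r. \<forall>y\<in>Field r. below s (g x) (g y) \<longleftrightarrow> below r x y)"
proof -
  from assms obtain g where "BNF_Wellorder_Embedding.iso r s g" unfolding ordIso_def by blast
  then have g: "bij_betw g (Field r) (Field s)"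
    and m: "\<And>x y. x \<in> Field r \<Longrightarrow> y \<in> Field r \<Longrightarrow> (x, y) \<in> r \<longleftrightarrow> (g x, g y) \<in> s"
    by (auto simp: iso_iff2)
  have "below s (g x) (g y) \<longleftrightarrow> below r x y" if "x \<in> Field r" "y \<in> Field r" for x y
    using m[OF that] g that unfolding below_def bij_betw_def inj_on_def by blast
  then show ?thesis using g m by blast
qed

section \<open>Ordinal sum, product and powers of \<open>\<omega>\<close>\<close>

lemma below_natLeq [simp]: "below natLeq i j \<longleftrightarrow> i < j"
  by (auto simp: below_def natLeq_def)

lemma below_natLeq_on: "below (natLeq_on n) i j \<longleftrightarrow> i < j \<and> j < n"
  by (auto simp: below_def)

lemma below_osum:
  assumes "Well_order r" "Well_order s"
  shows "below (r +o s) x y \<longleftrightarrow>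
    (case (x, y) of (Inl a, Inl a') \<Rightarrow> below r a a' | (Inr b, Inr b') \<Rightarrow> below s b b'
     | (Inl a, Inr b) \<Rightarrow> a \<in> Field r \<and> b \<in> Field s | (Inr _, Inl _) \<Rightarrow> False)"
  by (auto simp: below_def osum_def split: sum.splits)

lemma osum_well_order:
  assumes r: "Well_order r" and s: "Well_order s"
  shows "well_order_on (Field r <+> Field s) (r +o s)"
proof -
  let ?A = "Field r <+> Field s"
  let ?P = "below (r +o s)"
  have eq: "r +o s = {(x, y). x \<in> ?A \<and> y \<in> ?A \<and> (x = y \<or> ?P x y)}"
    by (auto simp: osum_def below_def intro: FieldI1 FieldI2 wo_refl[OF r] wo_refl[OF s])
  have "wf {(x, y). ?P x y}"
  proof (rule wf_subset)
    show "wf (inv_image ({(i :: nat, j). i < j} <*lex*> ({(x, y). below r x y} <*lex*> {(x, y). below s x y}))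
        (\<lambda>x. case x of Inl a \<Rightarrow> (0, a, undefined) | Inr b \<Rightarrow> (1, undefined, b)))"
      by (intro wf_inv_image wf_lex_prod wf_below r s wf_less)
  qed (auto simp: below_osum[OF r s] split: sum.splits)
  then have "wf {(x, y). x \<in> ?A \<and> y \<in> ?A \<and> ?P x y}"
    by (rule wf_subset) auto
  then have "well_order_on ?A {(x, y). x \<in> ?A \<and> y \<in> ?A \<and> (x = y \<or> ?P x y)}"
    by (intro well_order_on_strictI)
      (auto simp: below_osum[OF r s] split: sum.splits
        dest: below_trans[OF r] below_trans[OF s] below_total[OF r] below_total[OF s])
  then show ?thesis using eq by simp
qed

lemma below_oprod:
  assumes "Well_order r" "Well_order s"
  shows "below (r *o s) (a, b) (a', b') \<longleftrightarrow>
    a \<in> Field r \<and> a' \<in> Field r \<and> b \<in> Field s \<and> b' \<in> Field s \<and>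
    (below s b b' \<or> b = b' \<and> below r a a')"
  using wo_refl[OF assms(1)] wo_refl[OF assms(2)]
  by (auto simp: below_def oprod_def Field_def)

lemma oprod_well_order:
  assumes r: "Well_order r" and s: "Well_order s"
  shows "well_order_on (Field r \<times> Field s) (r *o s)"
proof -
  let ?A = "Field r \<times> Field s"
  let ?P = "below (r *o s)"
  have eq: "r *o s = {(x, y). x \<in> ?A \<and> y \<in> ?A \<and> (x = y \<or> ?P x y)}"
    using wo_refl[OF r] wo_refl[OF s] by (auto simp: oprod_def below_def Field_def)
  have "wf {(x, y). ?P x y}"
  proof (rule wf_subset)
    show "wf (inv_image ({(x, y). below s x y} <*lex*> {(x, y). below r x y}) prod.swap)"
      by (intro wf_inv_image wf_lex_prod wf_below r s)
  qed (auto simp: below_oprod[OF r s])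
  then have "wf {(x, y). x \<in> ?A \<and> y \<in> ?A \<and> ?P x y}"
    by (rule wf_subset) auto
  then have "well_order_on ?A {(x, y). x \<in> ?A \<and> y \<in> ?A \<and> (x = y \<or> ?P x y)}"
    using below_total[OF s] below_total[OF r]
    by (intro well_order_on_strictI)
      (auto simp: below_oprod[OF r s] dest: below_trans[OF r] below_trans[OF s], blast+)
  then show ?thesis using eq by simp
qed

definition supp :: "'b rel \<Rightarrow> ('b \<Rightarrow> nat) \<Rightarrow> 'b set"
  where "supp s f = {b \<in> Field s. f b \<noteq> 0}"

lemma zero_natLeq: "wo_rel.zero natLeq = 0"
proof -
  have "(0 :: nat) = wo_rel.minim natLeq UNIV"
    by (rule wo_rel.equals_minim[OF natLeq_wo_rel]) (simp_all add: Field_natLeq, simp add: natLeq_def)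
  then show ?thesis
    using natLeq_wo_rel by (simp add: wo_rel.zero_def Field_natLeq)
qed

lemma fin_funs_iff:
  "f \<in> oexp_carrier natLeq s \<longleftrightarrow> finite (supp s f) \<and> (\<forall>b. b \<notin> Field s \<longrightarrow> f b = undefined)"
  by (auto simp: oexp_carrier_def Func_def zero_natLeq Field_natLeq supp_def)

lemma fin_funs_eqI:
  assumes "f \<in> oexp_carrier natLeq s" "g \<in> oexp_carrier natLeq s"
    "\<And>b. b \<in> Field s \<Longrightarrow> f b = g b"
  shows "f = g"
  using assms by (metis ext fin_funs_iff)

lemma below_oexp:
  assumes s: "Well_order s"
  shows "below (natLeq ^o s) f g \<longleftrightarrow> f \<in> oexp_carrier natLeq s \<and> g \<in> oexp_carrier natLeq s \<and>
    (\<exists>b \<in> Field s. f b < g b \<and> (\<forall>c. below s b c \<longrightarrow> f c = g c))"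
  by (auto simp: below_def oexp_def natLeq_def aboveS_def)
    (metis le_neq_implies_less, metis less_imp_le less_not_refl)

text \<open>A function with finite support is the multiset in which each place occurs as often as its
  value says; comparing two functions at the largest place where they differ is then a case of the
  well-founded multiset ordering.\<close>

lemma wf_oexp:
  assumes s: "Well_order s"
  shows "wf {(f, g). below (natLeq ^o s) f g}"
proof (rule wf_subset)
  let ?M = "\<lambda>f. \<Sum>b\<in>supp s f. replicate_mset (f b) b"
  have cnt: "count (?M f) b = f b" if "f \<in> oexp_carrier natLeq s" "b \<in> Field s" for f b
  proof -
    have fin: "finite (supp s f)" using that by (simp add: fin_funs_iff)
    have "count (?M f) b = (\<Sum>c\<in>supp s f. if c = b then f b else 0)"
      by (auto simp: count_sum intro!: sum.cong)
    also have "\<dots> = f b" using fin that by (auto simp: supp_def)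
    finally show ?thesis .
  qed
  have sub: "set_mset (?M f) \<subseteq> Field s" if "f \<in> oexp_carrier natLeq s" for f
  proof -
    have "finite (supp s f)" using that by (simp add: fin_funs_iff)
    then show ?thesis by (auto simp: set_mset_sum supp_def split: if_splits)
  qed
  show "wf (inv_image (mult {(x, y). below s x y}) ?M)"
    by (intro wf_inv_image wf_mult wf_below s)
  show "{(f, g). below (natLeq ^o s) f g} \<subseteq> inv_image (mult {(x, y). below s x y}) ?M"
  proof clarify
    fix f g assume "below (natLeq ^o s) f g"
    then obtain b where f: "f \<in> oexp_carrier natLeq s" and g: "g \<in> oexp_carrier natLeq s"
      and b: "b \<in> Field s" "f b < g b" and above: "\<And>c. below s b c \<Longrightarrow> f c = g c"
      by (auto simp: below_oexp[OF s])
    let ?I = "?M f \<inter># ?M g"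
    have bin: "b \<in># ?M g - ?M f"
      using b cnt[OF f] cnt[OF g] by (simp add: in_diff_count)
    have "below s c b" if "c \<in># ?M f - ?M g" for c
    proof -
      have c: "c \<in> Field s" using that sub[OF f] by (meson in_diffD subsetD)
      then have "g c < f c"
        using that cnt[OF f] cnt[OF g] by (simp add: in_diff_count)
      then show ?thesis using below_total[OF s c b(1)] above[of c] b by auto
    qed
    then have "(?I + (?M f - ?M g), ?I + (?M g - ?M f)) \<in> mult {(x, y). below s x y}"
      using bin by (intro one_step_implies_mult) auto
    moreover have "?I + (?M f - ?M g) = ?M f" "?I + (?M g - ?M f) = ?M g"
      by (simp_all only: multiset_eq_iff count_union count_diff count_inter_mset) auto
    ultimately show "(f, g) \<in> inv_image (mult {(x, y). below s x y}) ?M" by simp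
  qed
qed

lemma oexp_well_order:
  assumes s: "Well_order s"
  shows "well_order_on (oexp_carrier natLeq s) (natLeq ^o s)"
proof -
  let ?A = "oexp_carrier natLeq s"
  let ?P = "below (natLeq ^o s)"
  have eq: "natLeq ^o s = {(x, y). x \<in> ?A \<and> y \<in> ?A \<and> (x = y \<or> ?P x y)}"
    by (auto simp: oexp_def below_def)
  have trans: "?P f h" if "?P f g" "?P g h" for f g h
  proof -
    from that(1) obtain b where f: "f \<in> ?A" and b: "b \<in> Field s" "f b < g b"
      "\<And>c. below s b c \<Longrightarrow> f c = g c" by (auto simp: below_oexp[OF s])
    from that(2) obtain d where h: "h \<in> ?A" and d: "d \<in> Field s" "g d < h d"
      "\<And>c. below s d c \<Longrightarrow> g c = h c" by (auto simp: below_oexp[OF s])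
    consider "below s b d" | "b = d" | "below s d b" using below_total[OF s b(1) d(1)] by blast
    then show ?thesis
    proof cases
      case 1
      then show ?thesis using f h d b(3) below_trans[OF s 1]
        by (auto simp: below_oexp[OF s] intro!: bexI[of _ d])
    next
      case 2
      then show ?thesis using f h d b
        by (auto simp: below_oexp[OF s] intro!: bexI[of _ d])
    next
      case 3
      then show ?thesis using f h b d(3) below_trans[OF s 3]
        by (auto simp: below_oexp[OF s] intro!: bexI[of _ b])
    qed
  qed
  have total: "?P f g \<or> f = g \<or> ?P g f" if f: "f \<in> ?A" and g: "g \<in> ?A" for f g
  proof (cases "f = g")
    case False
    let ?D = "{b \<in> Field s. f b \<noteq> g b}"
    have "?D \<noteq> {}" using fin_funs_eqI[OF f g] False by blast
    moreover have "finite ?D"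
      by (rule finite_subset[of _ "supp s f \<union> supp s g"]) (use f g in \<open>auto simp: fin_funs_iff supp_def\<close>)
    ultimately obtain b where b: "b \<in> ?D" "\<forall>c\<in>?D. (c, b) \<in> s"
      using wo_greatest[OF s, of ?D] by blast
    then have "f c = g c" if "below s b c" for c
      using that below_Field[OF that] b(2) below_not_le[OF s that] by blast
    then show ?thesis using b(1) f g
      by (cases "f b < g b") (auto simp: below_oexp[OF s] intro!: bexI[of _ b])
  qed simp
  have "wf {(x, y). x \<in> ?A \<and> y \<in> ?A \<and> ?P x y}"
    using wf_oexp[OF s] by (rule wf_subset) auto
  then have "well_order_on ?A {(x, y). x \<in> ?A \<and> y \<in> ?A \<and> (x = y \<or> ?P x y)}"
    using total by (intro well_order_on_strictI) (auto dest: trans)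
  then show ?thesis using eq by simp
qed

lemma power_times_well_order:
  assumes "Well_order \<beta>"
  shows "Well_order ((natLeq ^o \<beta>) *o natLeq_on (n + 1))"
    and "Field ((natLeq ^o \<beta>) *o natLeq_on (n + 1)) = oexp_carrier natLeq \<beta> \<times> {..n}"
proof -
  note pow = well_order_on_Field[OF oexp_well_order[OF assms]]
  note p = well_order_on_Field[OF oprod_well_order[OF conjunct2[OF pow] natLeq_on_Well_order[of "n + 1"]]]
  show "Well_order ((natLeq ^o \<beta>) *o natLeq_on (n + 1))" using p by blast
  have "{x. x < n + 1} = {..n}" by auto
  then show "Field ((natLeq ^o \<beta>) *o natLeq_on (n + 1)) = oexp_carrier natLeq \<beta> \<times> {..n}"
    using p pow by (simp only: Field_natLeq_on)
qed

lemma below_power_times: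
  assumes "Well_order \<beta>"
  shows "below ((natLeq ^o \<beta>) *o natLeq_on (n + 1)) (f, k) (g, l) \<longleftrightarrow>
    f \<in> oexp_carrier natLeq \<beta> \<and> g \<in> oexp_carrier natLeq \<beta> \<and> k \<le> n \<and> l \<le> n \<and>
    (k < l \<or> k = l \<and> below (natLeq ^o \<beta>) f g)"
proof -
  note pow = well_order_on_Field[OF oexp_well_order[OF assms]]
  show ?thesis
    using pow below_oprod[OF conjunct2[OF pow] natLeq_on_Well_order[of "n + 1"], of f k g l]
    by (auto simp only: Field_natLeq_on below_natLeq_on)
qed


section \<open>What the search does\<close>

text \<open>The traversal is determined by two rules: a vertex other than the first one is visited only
  after one of its neighbours, and whenever a vertex is visited, it is the least vertex having a
  visited neighbour.\<close>

locale infinite_search = wellordered_connected_graph V E r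
  for V :: "'v set" and E r +
  assumes infinite_V: "infinite V"
begin

abbreviation I where "I \<equiv> search_index V"
abbreviation S where "S \<equiv> search_stage I V E r"
abbreviation T where "T \<equiv> traversal V E r"
abbreviation v0 where "v0 \<equiv> wo_rel.minim r V"

lemma r_wo: "Well_order r" and r_Field: "Field r = V"
  using well_order_on_Field[OF wellordered] by auto

lemma I_wo: "Well_order I"
  using cardSuc_Card_order[OF card_of_Card_order] card_order_on_well_order_on by blast

sublocale I: wo_rel I
  using I_wo by (simp add: wo_rel_def)

lemma Field_I_infinite: "infinite (Field I)"
  using infinite_V cardSuc_finite[OF card_of_Card_order, of V] by simp

lemma aboveS_I: "i \<in> Field I \<Longrightarrow> aboveS I i \<noteq> {}"
  using infinite_Card_order_limit[OF cardSuc_Card_order[OF card_of_Card_order] Field_I_infinite]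
  by (fastforce simp: aboveS_def)

lemma zero_I: "I.zero \<in> Field I"
  using I.zero_in_Field Field_I_infinite by fastforce

lemma v0_in: "v0 \<in> V" and v0_least: "v \<in> V \<Longrightarrow> (v0, v) \<in> r"
  using wo_rel.minim_in[of r V] wo_rel.minim_least[of r V] r_wo r_Field vertices_nonempty
  by (auto simp: wo_rel_def)

definition front :: "'v set \<Rightarrow> 'v set"
  where "front A = {v \<in> V - A. \<exists>w\<in>A. (w, v) \<in> E}"

lemma S_zero: "S I.zero = {}"
  by (rule search_stage_zero[OF I_wo])

lemma S_one: "S (I.succ I.zero) = {v0}"
  by (rule search_stage_one[OF I_wo aboveS_I[OF zero_I]])

lemma S_succ:
  assumes "i \<in> Field I" "i \<noteq> I.zero"
  shows "S (I.succ i) = (if front (S i) = {} then S i else insert (wo_rel.minim r (front (S i))) (S i))"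
  using search_stage_succ[OF I_wo aboveS_I[OF assms(1)] assms(2), of V E r]
  by (simp only: search_step_def front_def Let_def)

lemma S_lim: "I.isLim i \<Longrightarrow> i \<noteq> I.zero \<Longrightarrow> S i = (\<Union>j\<in>underS I i. S j)"
  by (rule search_stage_limit[OF I_wo])

lemma minim_front:
  assumes "front A \<noteq> {}"
  shows "wo_rel.minim r (front A) \<in> front A"
    and "v \<in> front A \<Longrightarrow> (wo_rel.minim r (front A), v) \<in> r"
proof -
  have "front A \<subseteq> Field r" by (auto simp: front_def r_Field)
  then show "wo_rel.minim r (front A) \<in> front A"
    and "v \<in> front A \<Longrightarrow> (wo_rel.minim r (front A), v) \<in> r"
    using wo_rel.minim_in[of r "front A"] wo_rel.minim_least[of r "front A"] assms r_wo
    by (auto simp: wo_rel_def)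
qed

lemma S_succ_mono: "i \<in> Field I \<Longrightarrow> S i \<subseteq> S (I.succ i)"
  by (cases "i = I.zero") (auto simp: S_zero S_succ)

lemma S_mono: "(i, j) \<in> I \<Longrightarrow> S i \<subseteq> S j"
proof (induction j arbitrary: i rule: I.well_order_inductZSL)
  case Zero
  then have "i = I.zero" by (rule I.leq_zero_imp)
  then show ?case by simp
next
  case (Suc j)
  then have j: "j \<in> Field I" by (auto simp: aboveS_def Field_def)
  show ?case
  proof (cases "i = I.succ j")
    case False
    then have "i \<in> underS I (I.succ j)" using Suc.prems by (auto simp: underS_def)
    then have "(i, j) \<in> I" using I.underS_succ[OF Suc.hyps(1)] by (auto simp: under_def)
    then show ?thesis using Suc.IH S_succ_mono[OF j] by blast
  qed simp
next
  case (Lim j)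
  then show ?case by (cases "i = j") (auto simp: S_lim underS_def)
qed

lemma S_sub: "i \<in> Field I \<Longrightarrow> S i \<subseteq> V"
proof (induction i rule: I.well_order_inductZSL)
  case (Suc i)
  then have i: "i \<in> Field I" by (auto simp: aboveS_def Field_def)
  show ?case
  proof (cases "i = I.zero")
    case False
    then show ?thesis using Suc.IH[OF i] S_succ[OF i] minim_front(1)[of "S i"]
      by (auto simp: front_def)
  qed (simp add: S_one v0_in)
next
  case (Lim i)
  have "S i = (\<Union>j\<in>underS I i. S j)" using Lim S_lim by blast
  moreover have "S j \<subseteq> V" if "j \<in> underS I i" for j
    using Lim that by (auto simp: underS_def dest: FieldI1)
  ultimately show ?case by blast
qed (simp add: S_zero)

text \<open>A proper nonempty part of a connected graph has an edge leaving it, so a search that never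
  exhausts \<open>V\<close> adds a new vertex at each of the more than \<open>|V|\<close> stages.\<close>

lemma front_nonempty:
  assumes "A \<subseteq> V" "A \<noteq> {}" "A \<noteq> V"
  shows "front A \<noteq> {}"
proof
  assume empty: "front A = {}"
  obtain u v where u: "u \<in> A" and v: "v \<in> V" "v \<notin> A" using assms by blast
  have "(u, v) \<in> E\<^sup>*" using connected u v assms by blast
  then have "v \<in> A"
    by (induction rule: rtrancl_induct) (use u empty edges in \<open>auto simp: front_def\<close>)
  then show False using v by simp
qed

lemma S_nonempty: "below I I.zero i \<Longrightarrow> v0 \<in> S i"
proof -
  assume i: "below I I.zero i"
  then have "(I.succ I.zero, i) \<in> I" using I.succ_smallest by (auto simp: below_def)
  then show ?thesis using S_mono S_one by blast
qed

lemma zero_below: "i \<in> Field I \<Longrightarrow> i \<noteq> I.zero \<Longrightarrow> below I I.zero i"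
  using I.zero_smallest by (auto simp: below_def)

lemma S_exhausts: "\<exists>i\<in>Field I. S i = V"
proof (rule ccontr)
  assume never: "\<not> ?thesis"
  have "\<exists>v. v \<in> S (I.succ i) \<and> v \<notin> S i" if i: "i \<in> Field I" for i
  proof (cases "i = I.zero")
    case False
    then have "front (S i) \<noteq> {}"
      using front_nonempty[OF S_sub[OF i]] S_nonempty[OF zero_below[OF i]] never i by blast
    then show ?thesis using S_succ[OF i False] minim_front(1)[of "S i"] by (auto simp: front_def)
  qed (simp add: S_zero S_one)
  then obtain new where new: "\<And>i. i \<in> Field I \<Longrightarrow> new i \<in> S (I.succ i) \<and> new i \<notin> S i"
    by metis
  have neq: "new i \<noteq> new j" if "below I i j" for i j
  proof -
    have "(I.succ i, j) \<in> I" using that I.succ_smallest by (auto simp: below_def)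
    then show ?thesis using new[of i] new[of j] S_mono[of "I.succ i" j] below_Field[OF that] by auto
  qed
  then have "inj_on new (Field I)"
    using below_total[OF I_wo] unfolding inj_on_def by metis
  moreover have "new ` Field I \<subseteq> V"
    using new S_sub I.succ_in_Field aboveS_I by blast
  ultimately have "|Field I| \<le>o |V|" using card_of_ordLeq by blast
  moreover have "|Field I| =o I"
    by (rule card_of_Field_ordIso[OF cardSuc_Card_order[OF card_of_Card_order]])
  moreover have "|V| <o I" by (rule cardSuc_greater[OF card_of_Card_order])
  ultimately show False
    using ordIso_symmetric ordIso_ordLeq_trans not_ordLess_ordLeq by blast
qed

abbreviation e where "e \<equiv> entry_stage V E r"

lemma entry:
  assumes v: "v \<in> V"
  shows "e v \<in> Field I" "v \<in> S (e v)" "i \<in> Field I \<Longrightarrow> v \<in> S i \<longleftrightarrow> (e v, i) \<in> I"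
proof -
  let ?M = "{i \<in> Field I. v \<in> S i}"
  have M: "?M \<subseteq> Field I" "?M \<noteq> {}" using S_exhausts v by auto
  have "e v \<in> ?M" unfolding entry_stage_def using I.minim_in[OF M] .
  then show 1: "e v \<in> Field I" "v \<in> S (e v)" by auto
  show "v \<in> S i \<longleftrightarrow> (e v, i) \<in> I" if "i \<in> Field I"
    unfolding entry_stage_def using I.minim_least[OF M(1), of i] that
      S_mono[OF _ ] 1(2)[unfolded entry_stage_def] by blast
qed

text \<open>The stage preceding the one at which \<open>v\<close> enters exists: nothing enters at stage 0 or at a
  limit.\<close>

lemma entry_pred:
  assumes v: "v \<in> V"
  obtains i where "i \<in> Field I" "e v = I.succ i" "\<And>w. w \<in> V \<Longrightarrow> w \<in> S i \<longleftrightarrow> below I (e w) (e v)"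
    "i = I.zero \<and> v = v0 \<or> i \<noteq> I.zero \<and> v \<in> front (S i) \<and> (\<forall>w\<in>front (S i). (v, w) \<in> r)"
proof -
  note ev = entry[OF v]
  have nz: "e v \<noteq> I.zero" using ev(2) S_zero by auto
  have "\<not> I.isLim (e v)"
  proof
    assume "I.isLim (e v)"
    then obtain j where "j \<in> underS I (e v)" "v \<in> S j" using S_lim nz ev(2) by blast
    then have j: "(j, e v) \<in> I" "j \<noteq> e v" "v \<in> S j" by (auto simp: underS_def)
    then have "(e v, j) \<in> I" using ev(3)[of j] by (auto simp: Field_def)
    then show False using j wo_antisym[OF I_wo] by blast
  qed
  then obtain i where i: "aboveS I i \<noteq> {}" "e v = I.succ i"
    unfolding I.isLim_def I.isSucc_def by blast
  have iF: "i \<in> Field I" using i(1) by (auto simp: aboveS_def Field_def)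
  have lt: "below I i (e v)" using I.succ_in[OF i(1)] I.succ_diff[OF i(1)] i(2) by (auto simp: below_def)
  have S_i: "w \<in> S i \<longleftrightarrow> below I (e w) (e v)" if "w \<in> V" for w
  proof -
    have "w \<in> S i \<longleftrightarrow> (e w, i) \<in> I" using entry(3)[OF that iF] .
    also have "\<dots> \<longleftrightarrow> e w \<in> underS I (I.succ i)" using I.underS_succ[OF i(1)] by (auto simp: under_def)
    also have "\<dots> \<longleftrightarrow> below I (e w) (e v)" using i(2) by (auto simp: underS_def below_def)
    finally show ?thesis .
  qed
  have "v \<notin> S i" using S_i[OF v] by simp
  then have "i = I.zero \<and> v = v0 \<or> i \<noteq> I.zero \<and> v \<in> front (S i) \<and> (\<forall>w\<in>front (S i). (v, w) \<in> r)"
    using ev(2) i(2) S_one S_succ[OF iF] minim_front[of "S i"]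
    by (cases "i = I.zero") (auto split: if_splits)
  then show ?thesis using that iF i(2) S_i by blast
qed

lemma entry_inj: "inj_on e V"
proof (rule inj_onI)
  fix v w assume v: "v \<in> V" and w: "w \<in> V" and eq: "e v = e w"
  obtain i where i: "i \<in> Field I" "e v = I.succ i"
    "i = I.zero \<and> v = v0 \<or> i \<noteq> I.zero \<and> v \<in> front (S i) \<and> (\<forall>w\<in>front (S i). (v, w) \<in> r)"
    using entry_pred[OF v] by metis
  obtain j where j: "j \<in> Field I" "e w = I.succ j"
    "j = I.zero \<and> w = v0 \<or> j \<noteq> I.zero \<and> w \<in> front (S j) \<and> (\<forall>u\<in>front (S j). (w, u) \<in> r)"
    using entry_pred[OF w] by metis
  have "i = j" using i j eq I.succ_inj aboveS_I by metis
  then show "v = w" using i(3) j(3) wo_antisym[OF r_wo] by blast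
qed

lemma below_T: "v \<in> V \<Longrightarrow> w \<in> V \<Longrightarrow> below T v w \<longleftrightarrow> below I (e v) (e w)"
  using entry_inj by (auto simp: below_def traversal_def dest: inj_onD)

lemma T_well_order: "well_order_on V T"
proof -
  have wf: "wf (inv_image {(x, y). below I x y} e)" by (intro wf_inv_image wf_below I_wo)
  have "well_order_on V {(v, w). v \<in> V \<and> w \<in> V \<and> (v = w \<or> below I (e v) (e w))}"
  proof (rule well_order_on_strictI)
    show "below I (e v) (e w) \<or> v = w \<or> below I (e w) (e v)" if "v \<in> V" "w \<in> V" for v w
      using below_total[OF I_wo entry(1)[OF that(1)] entry(1)[OF that(2)]] inj_onD[OF entry_inj _ that]
      by blast
    show "wf {(v, w). v \<in> V \<and> w \<in> V \<and> below I (e v) (e w)}"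
      by (rule wf_subset[OF wf]) (simp add: subset_iff in_inv_image)
  qed (simp, rule below_trans[OF I_wo])
  moreover have "T = {(v, w). v \<in> V \<and> w \<in> V \<and> (v = w \<or> below I (e v) (e w))}"
    by (auto simp: traversal_def below_def)
  ultimately show ?thesis by simp
qed

lemma T_wo: "Well_order T" and T_Field: "Field T = V"
  using well_order_on_Field[OF T_well_order] by auto

lemma T_first:
  assumes v: "v \<in> V"
  shows "(v0, v) \<in> T"
proof -
  obtain i where "e v = I.succ i" "i \<in> Field I" using entry_pred[OF v] by metis
  then have "below I I.zero (e v)"
    using zero_below entry(1)[OF v] entry(2)[OF v] S_zero by fastforce
  then have "v0 \<in> S (e v)" by (rule S_nonempty)
  then have "(e v0, e v) \<in> I" using entry(1)[OF v] entry(3)[OF v0_in] by blast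
  then show ?thesis using v v0_in entry_inj by (auto simp: traversal_def dest: inj_onD)
qed

lemma T_visited_neighbour:
  assumes v: "v \<in> V" "v \<noteq> v0"
  obtains u where "below T u v" "(u, v) \<in> E"
proof -
  obtain i where i: "i \<in> Field I" "\<And>w. w \<in> V \<Longrightarrow> w \<in> S i \<longleftrightarrow> below I (e w) (e v)" "v \<in> front (S i)"
    using entry_pred[OF v(1)] v(2) by metis
  then obtain u where "u \<in> S i" "(u, v) \<in> E" by (auto simp: front_def)
  then show ?thesis using that i(2)[of u] below_T[of u v] S_sub[OF i(1)] v by blast
qed

text \<open>When \<open>y\<close> was chosen, \<open>x\<close> was already a candidate because of its visited neighbour \<open>w\<close>.\<close>

lemma T_least_choice:
  assumes wy: "below T w y" and yx: "below T y x" and E: "(w, x) \<in> E"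
  shows "(y, x) \<in> r"
proof -
  have V: "w \<in> V" "y \<in> V" "x \<in> V" using below_Field[OF wy] below_Field[OF yx] by (simp_all add: T_Field)
  obtain i where i: "i \<in> Field I" "\<And>w. w \<in> V \<Longrightarrow> w \<in> S i \<longleftrightarrow> below I (e w) (e y)"
    "i = I.zero \<and> y = v0 \<or> i \<noteq> I.zero \<and> y \<in> front (S i) \<and> (\<forall>w\<in>front (S i). (y, w) \<in> r)"
    using entry_pred[OF V(2)] by metis
  have "w \<in> S i" using i(2)[OF V(1)] wy below_T[OF V(1,2)] by simp
  moreover have "x \<notin> S i"
    using i(2)[OF V(3)] below_T[OF V(2,3)] yx below_trans[OF I_wo, of "e x" "e y" "e x"] by auto
  ultimately have "x \<in> front (S i)" "i \<noteq> I.zero" using E V S_zero by (auto simp: front_def)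
  then show ?thesis using i(3) by blast
qed

end


section \<open>The upper bound\<close>

text \<open>In a search, \<open>descent\<close> holds with any neighbour of \<open>x\<close> visited before \<open>x\<close> as \<open>u\<close>, since the
vertices visited in between were preferred to \<open>x\<close>.\<close>

locale block_counting =
  fixes T r :: "'v rel" and B :: "'c rel" and blk :: "'v \<Rightarrow> 'c"
  assumes T: "Well_order T" and B: "Well_order B"
    and blk_in: "x \<in> Field T \<Longrightarrow> blk x \<in> Field B"
    and blk_mono: "(y, x) \<in> r \<Longrightarrow> (blk y, blk x) \<in> B"
    and blk_finite: "x \<in> Field T \<Longrightarrow> finite {y. (y, x) \<in> r \<and> blk y = blk x}"
    and descent: "x \<in> Field T \<Longrightarrow> (\<forall>y\<in>Field T. (x, y) \<in> T) \<or>
      (\<exists>u. below T u x \<and> (\<forall>y. below T u y \<longrightarrow> (y, x) \<in> T \<longrightarrow> (y, x) \<in> r))"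
begin

definition standing :: "'v \<Rightarrow> 'v set"
  where "standing x = {y. (y, x) \<in> T \<and> (\<forall>z. below T y z \<longrightarrow> (z, x) \<in> T \<longrightarrow> (blk z, blk y) \<in> B)}"

definition cnt :: "'v \<Rightarrow> 'c \<Rightarrow> nat"
  where "cnt x c = card {y \<in> standing x. blk y = c}"

text \<open>Let \<open>u\<close> be as in \<open>descent\<close>. An element standing at \<open>x\<close> and visited after \<open>u\<close> is \<open>\<le> x\<close>, and its
block is not lower than that of \<open>x\<close>: it is one of finitely many in the block of \<open>x\<close>. The others were
standing at \<open>u\<close> already.\<close>

lemma finite_standing: "x \<in> Field T \<Longrightarrow> finite (standing x)"
proof (induction x rule: below_induct[OF T])
  case (1 x)
  from descent[OF 1(2)] show ?case
  proof
    assume "\<forall>y\<in>Field T. (x, y) \<in> T"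
    then have "standing x \<subseteq> {x}"
      using wo_antisym[OF T] by (auto simp: standing_def dest: FieldI1)
    then show ?thesis using finite_subset by blast
  next
    assume "\<exists>u. below T u x \<and> (\<forall>y. below T u y \<longrightarrow> (y, x) \<in> T \<longrightarrow> (y, x) \<in> r)"
    then obtain u where u: "below T u x" "\<And>y. below T u y \<Longrightarrow> (y, x) \<in> T \<Longrightarrow> (y, x) \<in> r" by blast
    have uF: "u \<in> Field T" using below_Field[OF u(1)] by simp
    have "standing x \<subseteq> standing u \<union> {y. (y, x) \<in> r \<and> blk y = blk x}"
    proof
      fix y assume y: "y \<in> standing x"
      then have yx: "(y, x) \<in> T"
        and top: "\<And>z. below T y z \<Longrightarrow> (z, x) \<in> T \<Longrightarrow> (blk z, blk y) \<in> B"
        by (auto simp: standing_def)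
      have yF: "y \<in> Field T" using FieldI1[OF yx] .
      show "y \<in> standing u \<union> {y. (y, x) \<in> r \<and> blk y = blk x}"
      proof (cases "below T u y")
        case True
        then have yr: "(y, x) \<in> r" using u(2) yx by blast
        have "blk y = blk x"
        proof (cases "y = x")
          case False
          then have "(blk x, blk y) \<in> B"
            using top[of x] yx wo_refl[OF T 1(2)] by (simp add: below_def)
          then show ?thesis using blk_mono[OF yr] wo_antisym[OF B] by blast
        qed simp
        then show ?thesis using yr by simp
      next
        case False
        then have "(y, u) \<in> T" using not_below_iff[OF T uF yF] by simp
        moreover have "(blk z, blk y) \<in> B" if "below T y z" "(z, u) \<in> T" for z
          using top[OF that(1)] wo_trans[OF T that(2) below_in[OF u(1)]] .
        ultimately show ?thesis by (simp add: standing_def)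
      qed
    qed
    then show ?thesis
      using 1(1)[OF u(1) uF] blk_finite[OF 1(2)] finite_subset by blast
  qed
qed

text \<open>Although infinitely many elements may be visited between \<open>x\<close> and \<open>x'\<close>, their blocks have a
maximum: it is attained at one of the finitely many elements met when descending from \<open>x'\<close>.\<close>

lemma highest_block:
  "below T x x' \<Longrightarrow> \<exists>m. below T x m \<and> (m, x') \<in> T \<and>
    (\<forall>y. below T x y \<longrightarrow> (y, x') \<in> T \<longrightarrow> (blk y, blk m) \<in> B)"
proof (induction x' rule: below_induct[OF T])
  case (1 x')
  have xF: "x \<in> Field T" "x' \<in> Field T" using below_Field[OF 1(2)] by auto
  have refl: "(x', x') \<in> T" using wo_refl[OF T xF(2)] .
  have "\<not> (\<forall>y\<in>Field T. (x', y) \<in> T)" using 1(2) xF below_not_le[OF T] by blast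
  then obtain u where u: "below T u x'" "\<And>y. below T u y \<Longrightarrow> (y, x') \<in> T \<Longrightarrow> (y, x') \<in> r"
    using descent[OF xF(2)] by blast
  have uF: "u \<in> Field T" using below_Field[OF u(1)] by simp
  show ?case
  proof (cases "below T x u")
    case False
    then have "(u, x) \<in> T" using not_below_iff[OF T xF(1) uF] by simp
    then have "(blk y, blk x') \<in> B" if "below T x y" "(y, x') \<in> T" for y
      using blk_mono[OF u(2)] le_below_trans[OF T _ that(1)] that(2) by blast
    then show ?thesis using 1(2) refl by blast
  next
    case True
    obtain m where m: "below T x m" "(m, u) \<in> T"
      "\<And>y. below T x y \<Longrightarrow> (y, u) \<in> T \<Longrightarrow> (blk y, blk m) \<in> B"
      using 1(1)[OF u(1) True] by blast
    have mx': "(m, x') \<in> T" using wo_trans[OF T m(2) below_in[OF u(1)]] .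
    have cases: "(blk y, blk m) \<in> B \<or> (blk y, blk x') \<in> B" if y: "below T x y" "(y, x') \<in> T" for y
    proof (cases "below T u y")
      case True
      then show ?thesis using blk_mono[OF u(2)] y by blast
    next
      case False
      then show ?thesis using not_below_iff[OF T uF] below_Field[OF y(1)] m(3) y by blast
    qed
    have "blk m \<in> Field B" "blk x' \<in> Field B"
      using blk_in FieldI1[OF mx'] xF by auto
    then consider "(blk m, blk x') \<in> B" | "(blk x', blk m) \<in> B"
      using not_below_iff[OF B] below_in by metis
    then show ?thesis
    proof cases
      case 1
      then show ?thesis using cases wo_trans[OF B] \<open>below T x x'\<close> refl by meson
    next
      case 2
      then show ?thesis using cases wo_trans[OF B] m(1) mx' by meson
    qed
  qed
qed

text \<open>Take for \<open>c\<close> the highest block visited after \<open>x\<close> and up to \<open>x'\<close>. Nothing in a block \<open>\<ge> c\<close> is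
overtaken in that time, and nothing is added to blocks above \<open>c\<close>.\<close>

lemma cnt_increases:
  assumes less: "below T x x'"
  obtains c where "c \<in> Field B" "cnt x c < cnt x' c" "\<And>d. below B c d \<Longrightarrow> cnt x d = cnt x' d"
proof -
  have xF: "x \<in> Field T" "x' \<in> Field T" using below_Field[OF less] by auto
  obtain m where m: "below T x m" "(m, x') \<in> T"
    and max: "\<And>y. below T x y \<Longrightarrow> (y, x') \<in> T \<Longrightarrow> (blk y, blk m) \<in> B"
    using highest_block[OF less] by blast
  let ?c = "blk m"
  have mF: "m \<in> Field T" using FieldI1[OF m(2)] .
  have cF: "?c \<in> Field B" using blk_in[OF mF] .
  \<comment> \<open>For elements of blocks \<open>\<ge> c\<close> visited up to \<open>x\<close>, standing means the same at \<open>x\<close> and at \<open>x'\<close>.\<close>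
  have early: "y \<in> standing x' \<longleftrightarrow> y \<in> standing x" if y: "(y, x) \<in> T" "(?c, blk y) \<in> B" for y
  proof
    assume "y \<in> standing x'"
    then show "y \<in> standing x"
      using y wo_trans[OF T _ below_in[OF less]] by (auto simp: standing_def)
  next
    assume s: "y \<in> standing x"
    have "(blk z, blk y) \<in> B" if z: "below T y z" "(z, x') \<in> T" for z
    proof (cases "below T x z")
      case True
      then show ?thesis using max[OF True z(2)] wo_trans[OF B _ y(2)] by blast
    next
      case False
      then have "(z, x) \<in> T" using not_below_iff[OF T xF(1)] FieldI1[OF z(2)] by blast
      then show ?thesis using s z(1) by (simp add: standing_def)
    qed
    then show "y \<in> standing x'"
      using wo_trans[OF T y(1) below_in[OF less]] by (simp add: standing_def)
  qed
  have late: "(blk y, ?c) \<in> B" if "y \<in> standing x'" "(y, x) \<notin> T" for y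
    using that max[of y] not_below_iff[OF T xF(1), of y] FieldI1[of y x' T] by (auto simp: standing_def)
  have sub: "y \<in> standing x \<Longrightarrow> (y, x) \<in> T" for y by (simp add: standing_def)
  have m_standing: "m \<in> standing x'"
    using m max le_below_trans[OF T below_in[OF m(1)]] by (simp add: standing_def)
  have m_notin: "m \<notin> standing x" using sub below_not_le[OF T m(1)] by blast
  have refl: "(?c, ?c) \<in> B" using wo_refl[OF B cF] .
  have "{y \<in> standing x. blk y = ?c} \<subseteq> {y \<in> standing x'. blk y = ?c}"
    using early sub refl by auto
  then have "{y \<in> standing x. blk y = ?c} \<subset> {y \<in> standing x'. blk y = ?c}"
    using m_standing m_notin by auto
  then have "cnt x ?c < cnt x' ?c"
    unfolding cnt_def using finite_standing[OF xF(2)] by (intro psubset_card_mono) auto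
  moreover have "cnt x d = cnt x' d" if d: "below B ?c d" for d
  proof -
    have "{y \<in> standing x. blk y = d} = {y \<in> standing x'. blk y = d}"
      using early late sub below_in[OF d] below_not_le[OF B d] by blast
    then show ?thesis by (simp add: cnt_def)
  qed
  ultimately show ?thesis using that cF by blast
qed

end

lemma (in infinite_search) traversal_ordLeq:
  fixes \<beta> :: "'b rel"
  assumes \<beta>: "Well_order \<beta>" and iso: "r =o (natLeq *o \<beta>) +o natLeq_on n"
  shows "T \<le>o (natLeq ^o \<beta>) *o natLeq_on (n + 1)"
proof -
  note prod = well_order_on_Field[OF oprod_well_order[OF natLeq_Well_order \<beta>]]
  note sum = well_order_on_Field[OF osum_well_order[OF conjunct2[OF prod] natLeq_on_Well_order[of n]]]
  define top_block where "top_block = natLeq_on 1"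
  have top: "Well_order top_block" "Field top_block = {0}"
    unfolding top_block_def by (rule natLeq_on_Well_order, simp only: Field_natLeq_on, auto)
  note blocks = well_order_on_Field[OF osum_well_order[OF \<beta> top(1)]]
  let ?\<sigma> = "(natLeq *o \<beta>) +o natLeq_on n"
  let ?B = "\<beta> +o top_block"
  have sumF: "Field ?\<sigma> = (UNIV \<times> Field \<beta>) <+> {x. x < n}"
    using sum prod by (simp add: Field_natLeq Field_natLeq_on)
  have BF: "Field ?B = Field \<beta> <+> {0}"
    using blocks top by simp
  obtain g where g: "bij_betw g V (Field ?\<sigma>)"
    and g_le: "\<And>x y. x \<in> V \<Longrightarrow> y \<in> V \<Longrightarrow> (g x, g y) \<in> ?\<sigma> \<longleftrightarrow> (x, y) \<in> r"
    and "\<And>x y. x \<in> V \<Longrightarrow> y \<in> V \<Longrightarrow> below ?\<sigma> (g x) (g y) \<longleftrightarrow> below r x y"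
    using ordIso_bij[OF iso, unfolded r_Field] by blast
  have g_in: "g x \<in> (UNIV \<times> Field \<beta>) <+> {x. x < n}" if "x \<in> V" for x
    using g that sumF by (auto simp: bij_betw_def)
  define blk where "blk x = (case g x of Inl p \<Rightarrow> Inl (snd p) | Inr _ \<Rightarrow> Inr (0 :: nat))" for x
  have rV: "x \<in> V \<and> y \<in> V" if "(x, y) \<in> r" for x y
    using that r_Field by (auto simp: Field_def)
  interpret C: block_counting T r ?B blk
  proof
    show "Well_order T" "Well_order ?B" using T_wo blocks by auto
    show "blk x \<in> Field ?B" if "x \<in> Field T" for x
      using g_in[of x] that T_Field by (auto simp: BF blk_def)
    show "(blk y, blk x) \<in> ?B" if "(y, x) \<in> r" for x y
      using g_le[of y x] rV[OF that] g_in[of y] that wo_refl[OF top(1)]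
      by (auto simp: blk_def osum_def oprod_def top intro: FieldI1)
    show "finite {y. (y, x) \<in> r \<and> blk y = blk x}" if "x \<in> Field T" for x
    proof -
      have x: "x \<in> V" using that T_Field by simp
      let ?Y = "{y. (y, x) \<in> r \<and> blk y = blk x}"
      have "g y \<in> (case g x of Inl (j, b) \<Rightarrow> (\<lambda>i. Inl (i, b)) ` {..j} | Inr _ \<Rightarrow> Inr ` {..<n})"
        if y: "y \<in> ?Y" for y
      proof -
        have "(g y, g x) \<in> ?\<sigma>" "blk y = blk x" "y \<in> V" using y g_le rV by blast+
        then show ?thesis using g_in[of y]
          by (auto simp: blk_def osum_def oprod_def natLeq_def split: sum.splits)
      qed
      then have "g ` ?Y \<subseteq> (case g x of Inl (j, b) \<Rightarrow> (\<lambda>i. Inl (i, b)) ` {..j} | Inr _ \<Rightarrow> Inr ` {..<n})"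
        by blast
      then have "finite (g ` ?Y)"
        by (rule finite_subset) (auto split: sum.splits)
      moreover have "inj_on g ?Y"
        using g rV by (auto simp: bij_betw_def inj_on_def)
      ultimately show ?thesis using finite_imageD by blast
    qed
    show "(\<forall>y\<in>Field T. (x, y) \<in> T) \<or>
      (\<exists>u. below T u x \<and> (\<forall>y. below T u y \<longrightarrow> (y, x) \<in> T \<longrightarrow> (y, x) \<in> r))" if "x \<in> Field T" for x
    proof (cases "x = v0")
      case False
      have x: "x \<in> V" using that T_Field by simp
      obtain u where u: "below T u x" "(u, x) \<in> E" using T_visited_neighbour[OF x False] .
      have "(y, x) \<in> r" if "below T u y" "(y, x) \<in> T" for y
        using T_least_choice[OF that(1) _ u(2)] that(2) wo_refl[OF r_wo] x r_Field
        by (cases "y = x") (auto simp: below_def)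
      then show ?thesis using u by blast
    qed (use T_first T_Field in simp)
  qed
  \<comment> \<open>The counts of the blocks of type \<open>\<omega>\<close> are the coefficients below \<open>\<omega>\<^sup>\<beta>\<close>; the top block is never
    overtaken, so its count, which is at most \<open>n\<close>, is the coefficient of \<open>\<omega>\<^sup>\<beta>\<close> itself.\<close>
  define F where "F x = (\<lambda>b. if b \<in> Field \<beta> then C.cnt x (Inl b) else undefined, C.cnt x (Inr 0))" for x
  have fin: "finite (C.standing x)" if "x \<in> V" for x using C.finite_standing that T_Field by simp
  have fst_F: "fst (F x) \<in> oexp_carrier natLeq \<beta>" if x: "x \<in> V" for x
  proof -
    have "Inl ` supp \<beta> (fst (F x)) \<subseteq> blk ` C.standing x"
    proof
      fix c :: "'b + nat" assume "c \<in> Inl ` supp \<beta> (fst (F x))"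
      then have "C.cnt x c \<noteq> 0" by (auto simp: supp_def F_def)
      then have "{y \<in> C.standing x. blk y = c} \<noteq> {}" unfolding C.cnt_def by (metis card.empty)
      then show "c \<in> blk ` C.standing x" by blast
    qed
    then have "finite (Inl ` supp \<beta> (fst (F x)) :: ('b + nat) set)"
      by (rule finite_subset) (intro finite_imageI fin x)
    then have "finite (supp \<beta> (fst (F x)))" by (rule finite_imageD) simp
    then show ?thesis by (simp add: fin_funs_iff F_def)
  qed
  have snd_F: "snd (F x) < n + 1" if x: "x \<in> V" for x
  proof -
    let ?Y = "{y \<in> C.standing x. blk y = Inr 0}"
    have YV: "?Y \<subseteq> V" using T_Field by (auto simp: C.standing_def Field_def)
    have "g ` ?Y \<subseteq> Inr ` {..<n}"
    proof
      fix p assume "p \<in> g ` ?Y"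
      then obtain y where "y \<in> V" "blk y = Inr 0" "p = g y" using YV by auto
      then show "p \<in> Inr ` {..<n}" using g_in[of y] by (auto simp: blk_def split: sum.splits)
    qed
    moreover have "inj_on g ?Y" using g YV inj_on_subset by (auto simp: bij_betw_def)
    ultimately have "card ?Y \<le> card (Inr ` {..<n} :: ((nat \<times> 'b) + nat) set)"
      by (intro card_inj_on_le) auto
    then show ?thesis by (simp add: F_def C.cnt_def card_image)
  qed
  show ?thesis
  proof (rule strict_mono_imp_ordLeq[OF T_wo power_times_well_order(1)[OF \<beta>], where f = F])
    show "F x \<in> Field ((natLeq ^o \<beta>) *o natLeq_on (n + 1))" if "x \<in> Field T" for x
      unfolding power_times_well_order(2)[OF \<beta>]
      using that fst_F snd_F[of x] T_Field by (simp add: mem_Times_iff)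
    show "below ((natLeq ^o \<beta>) *o natLeq_on (n + 1)) (F x) (F x')" if less: "below T x x'" for x x'
    proof -
      have xV: "x \<in> V" "x' \<in> V" using below_Field[OF less] T_Field by auto
      obtain c where c: "c \<in> Field ?B" "C.cnt x c < C.cnt x' c"
        "\<And>d. below ?B c d \<Longrightarrow> C.cnt x d = C.cnt x' d"
        using C.cnt_increases[OF less] by blast
      note less_iff = below_power_times[OF \<beta>, of n "fst (F x)" "snd (F x)" "fst (F x')" "snd (F x')",
          unfolded prod.collapse]
      note mem = fst_F[OF xV(1)] fst_F[OF xV(2)] snd_F[OF xV(1)] snd_F[OF xV(2)]
      show ?thesis
      proof (cases c)
        case (Inl b)
        then have b: "b \<in> Field \<beta>" using c(1) BF by auto
        have "C.cnt x (Inr 0) = C.cnt x' (Inr 0)"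
          using c(3)[of "Inr 0"] b Inl by (simp add: below_osum[OF \<beta> top(1)] top)
        then have "snd (F x) = snd (F x')" by (simp add: F_def)
        moreover have "C.cnt x (Inl d) = C.cnt x' (Inl d)" if "below \<beta> b d" for d
          using c(3)[of "Inl d"] that Inl by (simp add: below_osum[OF \<beta> top(1)])
        then have "below (natLeq ^o \<beta>) (fst (F x)) (fst (F x'))"
          unfolding below_oexp[OF \<beta>] using mem b c(2) Inl below_Field[of \<beta> b]
          by (auto simp: F_def intro!: bexI[of _ b])
        ultimately show ?thesis
          using mem unfolding less_iff by simp
      next
        case (Inr k)
        then have "snd (F x) < snd (F x')" using c(1,2) BF by (auto simp: F_def)
        then show ?thesis
          using mem unfolding less_iff by simp
      qed
    qed
  qed
qed


section \<open>Prescribing a traversal\<close>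

text \<open>The graph joins each element to its parent, and the vertices outside the range of \<open>G\<close> to the
root. Suppose that the order \<open>\<theta>\<close> is violated, and consider the first vertex \<open>b\<close> visited before a
\<open>\<theta>\<close>-smaller one; let \<open>y\<close> be the \<open>\<theta>\<close>-least element skipped by \<open>b\<close>. The parents of \<open>b\<close> and of \<open>y\<close>
have been visited by then, so \<open>y\<close> lies between the parent of \<open>b\<close> and \<open>b\<close>. Hence \<open>y\<close> is placed at a
smaller vertex than \<open>b\<close>, and the search would have preferred it.\<close>

lemma traversal_of_parents:
  fixes r :: "'v rel" and \<theta> :: "'x rel" and par :: "'x \<Rightarrow> 'x" and G :: "'x \<Rightarrow> 'v"
  assumes r: "Well_order r" and inf: "infinite (Field r)"
    and \<theta>: "Well_order \<theta>" and org: "org \<in> Field \<theta>"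
    and inj: "inj_on G (Field \<theta>)" and G_in: "G ` Field \<theta> \<subseteq> Field r"
    and root: "\<And>v. v \<in> Field r \<Longrightarrow> (G org, v) \<in> r"
    and par: "\<And>y. y \<in> Field \<theta> \<Longrightarrow> y \<noteq> org \<Longrightarrow> below \<theta> (par y) y"
    and tops: "\<And>x y. y \<in> Field \<theta> \<Longrightarrow> y \<noteq> org \<Longrightarrow> below \<theta> (par y) x \<Longrightarrow> below \<theta> x y \<Longrightarrow>
      below r (G x) (G y)"
  shows "\<exists>E. wellordered_connected_graph (Field r) E r \<and> \<theta> \<le>o traversal (Field r) E r"
proof -
  define E0 where "E0 = {(G (par y), G y) | y. y \<in> Field \<theta> \<and> y \<noteq> org} \<union>
    {(G org, v) | v. v \<in> Field r \<and> v \<notin> G ` Field \<theta>}"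
  define E where "E = E0 \<union> E0\<inverse>"
  have par_in: "par y \<in> Field \<theta>" if "y \<in> Field \<theta>" "y \<noteq> org" for y
    using below_Field[OF par[OF that]] by simp
  have org_least: "(org, y) \<in> \<theta>" if y: "y \<in> Field \<theta>" for y
  proof -
    obtain m where m: "m \<in> Field \<theta>" "\<And>y. y \<in> Field \<theta> \<Longrightarrow> (m, y) \<in> \<theta>"
      using wo_least[OF \<theta>, of "Field \<theta>"] org by blast
    then have "m = org" using par[of m] par_in[of m] below_not_le[OF \<theta>] by blast
    then show ?thesis using m y by blast
  qed
  have E0: "u \<in> Field r \<and> v \<in> Field r \<and> u \<noteq> v" if "(u, v) \<in> E0" for u v
  proof -
    from that consider y where "y \<in> Field \<theta>" "y \<noteq> org" "u = G (par y)" "v = G y"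
      | "u = G org" "v \<in> Field r" "v \<notin> G ` Field \<theta>"
      by (auto simp: E0_def)
    then show ?thesis
    proof cases
      case 1
      then have "par y \<noteq> y" using par[of y] by auto
      then show ?thesis using 1 par_in[of y] inj G_in by (auto dest: inj_onD)
    next
      case 2
      then show ?thesis using org G_in by auto
    qed
  qed
  have from_root: "(G org, v) \<in> E\<^sup>*" if v: "v \<in> Field r" for v
  proof (cases "v \<in> G ` Field \<theta>")
    case False
    then show ?thesis using v by (auto simp: E_def E0_def)
  next
    case True
    then obtain y where y: "y \<in> Field \<theta>" "v = G y" by blast
    have "y \<in> Field \<theta> \<Longrightarrow> (G org, G y) \<in> E\<^sup>*" for y
    proof (induction y rule: below_induct[OF \<theta>])
      case (1 y)
      show ?case
      proof (cases "y = org")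
        case False
        then have "(G org, G (par y)) \<in> E\<^sup>*" using 1 par par_in by blast
        moreover have "(G (par y), G y) \<in> E" using False 1(2) by (auto simp: E_def E0_def)
        ultimately show ?thesis by (rule rtrancl_into_rtrancl)
      qed simp
    qed
    then show ?thesis using y by simp
  qed
  have sym: "sym E" unfolding E_def sym_def by blast
  have graph: "wellordered_connected_graph (Field r) E r"
  proof
    show "Field r \<noteq> {}" using inf by auto
    show "E \<subseteq> Field r \<times> Field r" using E0 by (auto simp: E_def)
    show "sym E" by (rule sym)
    show "irrefl E" using E0 by (auto simp: E_def irrefl_def)
    show "(u, v) \<in> E\<^sup>*" if "u \<in> Field r" "v \<in> Field r" for u v
      using from_root[OF that(1)] from_root[OF that(2)] sym_rtrancl[OF sym]
      by (meson rtrancl_trans symD)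
    show "well_order_on (Field r) r" by (rule r)
  qed
  interpret infinite_search "Field r" E r
    using graph inf by (simp add: infinite_search_def infinite_search_axioms_def)
  have v0: "v0 = G org"
    using v0_least v0_in root[OF v0_in] org G_in wo_antisym[OF r] by blast
  have GV: "G x \<in> Field T" if "x \<in> Field \<theta>" for x
    using that G_in T_Field by blast
  have T_total: "below T (G x) (G y) \<or> below T (G y) (G x)"
    if "x \<in> Field \<theta>" "y \<in> Field \<theta>" "x \<noteq> y" for x y
    using below_total[OF T_wo GV GV] that inj by (metis inj_onD)
  have mono: "\<forall>x. below \<theta> x y \<longrightarrow> below T (G x) (G y)" if "y \<in> Field \<theta>" for y
  proof (rule ccontr)
    define bad where "bad = {y \<in> Field \<theta>. \<exists>x. below \<theta> x y \<and> below T (G y) (G x)}"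
    assume "\<not> (\<forall>x. below \<theta> x y \<longrightarrow> below T (G x) (G y))"
    then have "y \<in> bad"
      using that T_total below_Field[of \<theta>] unfolding bad_def by (metis (mono_tags, lifting) below_irrefl mem_Collect_eq)
    then have "G ` bad \<noteq> {}" "G ` bad \<subseteq> Field T" using GV by (auto simp: bad_def)
    then obtain m where "m \<in> G ` bad" and m: "\<And>v. v \<in> G ` bad \<Longrightarrow> (m, v) \<in> T"
      using wo_least[OF T_wo] by metis
    then obtain b where b: "b \<in> bad" "m = G b" by blast
    have bF: "b \<in> Field \<theta>" using b by (simp add: bad_def)
    have early: "below T (G x) (G z)" if "below \<theta> x z" "below T (G z) (G b)" for x z
    proof -
      have "z \<notin> bad" using m b that(2) below_not_le[OF T_wo] by blast
      moreover have "x \<noteq> z" using that(1) by auto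
      ultimately show ?thesis using below_Field[OF that(1)] that(1) T_total[of x z]
        by (auto simp: bad_def)
    qed
    let ?late = "{x. below \<theta> x b \<and> below T (G b) (G x)}"
    have "?late \<noteq> {}" "?late \<subseteq> Field \<theta>"
      using b below_Field[of \<theta> _ b] by (auto simp: bad_def)
    then obtain y where y: "below \<theta> y b" "below T (G b) (G y)"
      and y_least: "\<And>x. x \<in> ?late \<Longrightarrow> (y, x) \<in> \<theta>"
      using wo_least[OF \<theta>, of ?late] by (metis (no_types, lifting) mem_Collect_eq)
    have yF: "y \<in> Field \<theta>" using below_Field[OF y(1)] by simp
    have "b \<noteq> org" using y(1) org_least[OF yF] below_not_le[OF \<theta>] by blast
    then have b_not_root: "G b \<noteq> v0" using v0 inj bF org by (metis inj_onD)
    have y_not_root: "y \<noteq> org"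
      using y(2) below_not_le[OF T_wo y(2)] T_first[of "G b"] v0 GV[OF bF] T_Field by auto
    have bV: "G b \<in> Field r" using bF G_in by blast
    obtain u where u: "below T u (G b)" "(u, G b) \<in> E"
      using T_visited_neighbour[OF bV b_not_root] .
    have "u = G (par b)"
    proof -
      from u(2) consider z where "z \<in> Field \<theta>" "z \<noteq> org" "u = G (par z)" "G b = G z"
        | z where "z \<in> Field \<theta>" "z \<noteq> org" "G b = G (par z)" "u = G z"
        | "G b = G org" | "G b \<notin> G ` Field \<theta>"
        by (auto simp: E_def E0_def)
      then show ?thesis
      proof cases
        case 1
        then show ?thesis using inj bF by (metis inj_onD)
      next
        case 2
        then have "below \<theta> b z" using par[OF 2(1,2)] par_in[OF 2(1,2)] inj bF by (metis inj_onD)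
        then have "below T (G y) (G z)"
          using early[of y z] below_trans[OF \<theta> y(1)] u(1) 2(4) by blast
        then show ?thesis
          using y(2) u(1) 2(4) below_trans[OF T_wo] below_irrefl by metis
      next
        case 3
        then show ?thesis using b_not_root v0 by simp
      next
        case 4
        then show ?thesis using bF by blast
      qed
    qed
    then have pb: "below T (G (par b)) (G b)" using u(1) by simp
    have pbF: "par b \<in> Field \<theta>" by (rule par_in[OF bF \<open>b \<noteq> org\<close>])
    have "par b \<noteq> y" using pb y(2) below_trans[OF T_wo] below_irrefl by metis
    moreover have "\<not> below \<theta> y (par b)"
      using early[OF _ pb] y(2) pb below_trans[OF T_wo] below_irrefl by metis
    ultimately have "below \<theta> (par b) y" using below_total[OF \<theta> pbF yF] by blast
    then have "below r (G y) (G b)" using tops[OF bF \<open>b \<noteq> org\<close> _ y(1)] by blast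
    moreover have "(G b, G y) \<in> r"
    proof (rule T_least_choice[OF _ y(2)])
      have py: "below \<theta> (par y) y" by (rule par[OF yF y_not_root])
      then have "par y \<notin> ?late" using y_least below_not_le[OF \<theta> py] by blast
      moreover have pyb: "below \<theta> (par y) b" using below_trans[OF \<theta> py y(1)] .
      moreover have "par y \<noteq> b" using pyb by auto
      ultimately show "below T (G (par y)) (G b)"
        using T_total[of "par y" b] below_Field[OF pyb] by auto
      show "(G (par y), G y) \<in> E" using yF y_not_root by (auto simp: E_def E0_def)
    qed
    ultimately show False using below_not_le[OF r] by blast
  qed
  have "\<theta> \<le>o T"
    by (rule strict_mono_imp_ordLeq[OF \<theta> T_wo, where f = G])
      (use GV mono below_Field[of \<theta>] in blast)+
  then show ?thesis using graph by blast
qed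


section \<open>Segments of a well-order without finite tails\<close>

lemma Field_Restr_Well_order: "Well_order r \<Longrightarrow> A \<subseteq> Field r \<Longrightarrow> Field (Restr r A) = A"
  using well_order_on_Restr well_order_on_Field by blast

lemma below_Restr: "below (Restr r A) x y \<longleftrightarrow> below r x y \<and> x \<in> A \<and> y \<in> A"
  by (auto simp: below_def)

text \<open>If the chain were longer than \<open>A\<close>, then \<open>A\<close> would be isomorphic to a proper initial segment of
the chain, but these are too small.\<close>

lemma chain_into_large_set:
  assumes c: "Well_order c" and p: "Well_order p" and C: "C \<subseteq> Field c" and A: "A \<subseteq> Field p"
    and small: "\<And>x. x \<in> C \<Longrightarrow> |{y \<in> C. (y, x) \<in> c}| <o |A|"
  shows "\<exists>h. (\<forall>x\<in>C. h x \<in> A) \<and> (\<forall>x\<in>C. \<forall>y\<in>C. below c x y \<longrightarrow> below p (h x) (h y))"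
proof -
  let ?c = "Restr c C" and ?p = "Restr p A"
  have wo: "Well_order ?c" "Well_order ?p" using Well_order_Restr c p by auto
  have F: "Field ?c = C" "Field ?p = A" using Field_Restr_Well_order c p C A by auto
  have "\<not> ?p <o ?c"
  proof
    assume "?p <o ?c"
    then obtain a where a: "a \<in> Field ?c" "?p =o Restr ?c (underS ?c a)"
      using ordLess_iff_ordIso_Restr[OF wo] by blast
    have "|A| =o |Field (Restr ?c (underS ?c a))|"
      using card_of_cong[OF a(2)] F by simp
    moreover have "Field (Restr ?c (underS ?c a)) \<subseteq> {y \<in> C. (y, a) \<in> c}"
      by (auto simp: Field_def underS_def)
    ultimately have "|A| \<le>o |{y \<in> C. (y, a) \<in> c}|"
      using card_of_mono1 ordIso_ordLeq_trans by blast
    then show False using small[of a] a(1) F not_ordLess_ordLeq by blast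
  qed
  then have "?c \<le>o ?p" using wo not_ordLess_iff_ordLeq by blast
  then obtain h where "\<And>x. x \<in> C \<Longrightarrow> h x \<in> A"
    and "\<And>x y. below ?c x y \<Longrightarrow> below ?p (h x) (h y)"
    using ordLeq_strict_monoE[of ?c ?p] F by metis
  then show ?thesis unfolding below_Restr by blast
qed

lemma card_Fpow_ordLess:
  assumes "infinite B" "|A| <o |B|"
  shows "|Fpow A| <o |B|"
proof (cases "finite A")
  case True
  then have "finite (Fpow A)" by (simp add: Fpow_def)
  then show ?thesis using assms(1) finite_ordLess_infinite2 by blast
next
  case False
  then show ?thesis using assms(2) card_of_Fpow_infinite ordIso_ordLess_trans by blast
qed

text \<open>The positions \<open>y \<ge> x\<close> with fewer than \<open>|tail x|\<close> elements in \<open>[x, y)\<close> are near \<open>x\<close>; a segment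
consists of the positions near its first element, and each position belongs to the segment that
begins at the least element it is near to. This makes a segment as large as the whole tail from
its first element on, while its proper initial segments are smaller.\<close>

locale long_tails =
  fixes p :: "'a rel"
  assumes p: "Well_order p" and long: "x \<in> Field p \<Longrightarrow> infinite {y. (x, y) \<in> p}"
begin

definition tail :: "'a \<Rightarrow> 'a set" where "tail x = {y. (x, y) \<in> p}"

definition gap :: "'a \<Rightarrow> 'a \<Rightarrow> 'a set" where "gap x y = {z. (x, z) \<in> p \<and> below p z y}"

definition near :: "'a \<Rightarrow> 'a \<Rightarrow> bool" where "near x y \<longleftrightarrow> (x, y) \<in> p \<and> |gap x y| <o |tail x|"

definition start :: "'a \<Rightarrow> 'a" where "start y = wo_rel.minim p {x. near x y}"

definition segment :: "'a \<Rightarrow> 'a set" where "segment s = {y \<in> Field p. start y = s}"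

lemma infinite_tail: "x \<in> Field p \<Longrightarrow> infinite (tail x)"
  using long by (simp add: tail_def)

lemma near_of_finite: "(x, y) \<in> p \<Longrightarrow> finite (gap x y) \<Longrightarrow> near x y"
  unfolding near_def using finite_ordLess_infinite2 infinite_tail FieldI1 by metis

lemma near_refl: "x \<in> Field p \<Longrightarrow> near x x"
proof (rule near_of_finite)
  have "gap x x = {}" using below_not_le[OF p] by (auto simp: gap_def)
  then show "finite (gap x x)" by simp
qed (rule wo_refl[OF p])

text \<open>A union of two sets of size less than an infinite cardinal again has size less than it.\<close>

lemma near_trans:
  assumes "near x y" "near y z"
  shows "near x z"
proof -
  have xy: "(x, y) \<in> p" and yz: "(y, z) \<in> p" using assms by (auto simp: near_def)
  have "tail y \<subseteq> tail x" using wo_trans[OF p xy] by (auto simp: tail_def)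
  then have "|gap y z| <o |tail x|"
    using assms(2) card_of_mono1 ordLess_ordLeq_trans unfolding near_def by blast
  moreover have "|gap x y| <o |tail x|" using assms(1) by (simp add: near_def)
  ultimately have "|gap x y \<union> gap y z| <o |tail x|"
    using card_of_Un_ordLess_infinite infinite_tail FieldI1[OF xy] by blast
  moreover have "gap x z \<subseteq> gap x y \<union> gap y z"
    using not_below_iff[OF p _ FieldI2[OF xy]] by (auto simp: gap_def dest: FieldI2)
  ultimately have "|gap x z| <o |tail x|"
    using card_of_mono1 ordLeq_ordLess_trans by blast
  then show ?thesis using wo_trans[OF p xy yz] by (simp add: near_def)
qed

lemma near_left: "near x z \<Longrightarrow> (x, y) \<in> p \<Longrightarrow> (y, z) \<in> p \<Longrightarrow> near x y"
proof -
  assume xz: "near x z" and xy: "(x, y) \<in> p" and yz: "(y, z) \<in> p"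
  have "gap x y \<subseteq> gap x z" using below_le_trans[OF p _ yz] by (auto simp: gap_def)
  then show ?thesis
    using xz xy card_of_mono1 ordLeq_ordLess_trans unfolding near_def by blast
qed

lemma start:
  assumes y: "y \<in> Field p"
  shows near_start: "near (start y) y" and start_least: "near x y \<Longrightarrow> (start y, x) \<in> p"
proof -
  have M: "{x. near x y} \<subseteq> Field p" "{x. near x y} \<noteq> {}"
    using near_refl[OF y] by (auto simp: near_def dest: FieldI1)
  then show "near (start y) y"
    unfolding start_def using wo_rel.minim_in[of p "{x. near x y}"] p by (simp add: wo_rel_def)
  show "near x y \<Longrightarrow> (start y, x) \<in> p"
    unfolding start_def using wo_rel.minim_least[of p "{x. near x y}" x] M p by (simp add: wo_rel_def)
qed

lemma start_le: "y \<in> Field p \<Longrightarrow> (start y, y) \<in> p"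
  using near_start by (simp add: near_def)

lemma start_in: "y \<in> Field p \<Longrightarrow> start y \<in> Field p"
  using start_le FieldI1 by metis

lemma start_mono:
  assumes yz: "(y, z) \<in> p"
  shows "(start y, start z) \<in> p"
proof -
  have F: "y \<in> Field p" "z \<in> Field p" using FieldI1[OF yz] FieldI2[OF yz] by auto
  show ?thesis
  proof (cases "below p y (start z)")
    case True
    then show ?thesis using start_le[OF F(1)] wo_trans[OF p] below_in by metis
  next
    case False
    then have "(start z, y) \<in> p" using not_below_iff[OF p F(1) start_in[OF F(2)]] by simp
    then show ?thesis using near_left[OF near_start[OF F(2)] _ yz] start_least[OF F(1)] by blast
  qed
qed

lemma start_start: "y \<in> Field p \<Longrightarrow> start (start y) = start y"
  using near_trans[OF near_start[OF start_in] near_start] start_least start_le[OF start_in]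
    wo_antisym[OF p] by metis

lemma segment_sub: "segment s \<subseteq> tail s"
  using start_le by (auto simp: segment_def tail_def)

text \<open>If the segment were smaller than the tail, then the first position beyond it would still be near
its first element, and would belong to it.\<close>

lemma segment_large:
  assumes y: "y \<in> Field p"
  shows "|tail (start y)| =o |segment (start y)|"
proof -
  let ?s = "start y"
  have "\<not> |segment ?s| <o |tail ?s|"
  proof
    assume small: "|segment ?s| <o |tail ?s|"
    then have "tail ?s - segment ?s \<noteq> {}"
      using segment_sub[of ?s] by (metis Diff_eq_empty_iff card_of_mono1 not_ordLess_ordLeq)
    moreover have "tail ?s - segment ?s \<subseteq> Field p" by (auto simp: tail_def dest: FieldI2)
    ultimately obtain q where q: "q \<in> tail ?s - segment ?s"
      and least: "\<And>z. z \<in> tail ?s - segment ?s \<Longrightarrow> (q, z) \<in> p"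
      using wo_least[OF p] by metis
    have sq: "(?s, q) \<in> p" using q by (simp add: tail_def)
    have "gap ?s q \<subseteq> segment ?s"
      using least below_not_le[OF p] by (auto simp: gap_def tail_def)
    then have "near ?s q"
      using small sq card_of_mono1 ordLeq_ordLess_trans unfolding near_def by blast
    then have "(start q, ?s) \<in> p" using start_least FieldI2[OF sq] by blast
    moreover have "(?s, start q) \<in> p" using start_mono[OF sq] start_start[OF y] by simp
    ultimately have "q \<in> segment ?s"
      using wo_antisym[OF p] FieldI2[OF sq] by (simp add: segment_def)
    then show False using q by simp
  qed
  then have "|tail ?s| \<le>o |segment ?s|"
    using not_ordLess_iff_ordLeq card_of_Well_order by blast
  then show ?thesis using card_of_mono1[OF segment_sub] ordIso_iff_ordLeq by blast
qed

lemma infinite_segment: "y \<in> Field p \<Longrightarrow> infinite (segment (start y))"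
  using segment_large infinite_tail start_in card_of_ordIso_finite by blast

lemma segment_initial_small:
  assumes q: "q \<in> segment s"
  shows "|{z \<in> segment s. (z, q) \<in> p}| <o |segment s|"
proof -
  have qF: "q \<in> Field p" and s: "start q = s" using q by (auto simp: segment_def)
  have "{z \<in> segment s. (z, q) \<in> p} \<subseteq> gap s q \<union> {q}"
    using segment_sub[of s] by (auto simp: gap_def tail_def below_def)
  moreover have "|gap s q \<union> {q}| <o |tail s|"
  proof (rule card_of_Un_ordLess_infinite)
    show "infinite (tail s)" using infinite_tail start_in[OF qF] s by simp
    then show "|{q}| <o |tail s|" using finite_ordLess_infinite2 by blast
    show "|gap s q| <o |tail s|" using near_start[OF qF] s by (simp add: near_def)
  qed
  ultimately have "|{z \<in> segment s. (z, q) \<in> p}| <o |tail s|"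
    using card_of_mono1 ordLeq_ordLess_trans by blast
  then show ?thesis using segment_large[OF qF] s ordLess_ordIso_trans by blast
qed

end


section \<open>Placing the elements of \<open>\<omega>\<^sup>\<beta> \<cdot> (n + 1)\<close>\<close>

locale power_placement =
  fixes \<beta> :: "'b rel" and n :: nat
  assumes \<beta>: "Well_order \<beta>"
begin

definition pos :: "(nat \<times> 'b) rel" where "pos = natLeq *o \<beta>"

lemma pos_wo: "Well_order pos" and Field_pos: "Field pos = UNIV \<times> Field \<beta>"
  using well_order_on_Field[OF oprod_well_order[OF natLeq_Well_order \<beta>]]
  by (auto simp: pos_def Field_natLeq)

lemma below_pos: "below pos (i, b) (j, c) \<longleftrightarrow>
    b \<in> Field \<beta> \<and> c \<in> Field \<beta> \<and> (below \<beta> b c \<or> b = c \<and> i < j)"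
  unfolding pos_def below_oprod[OF natLeq_Well_order \<beta>] by (simp add: Field_natLeq)

lemma le_pos: "((i, b), (j, c)) \<in> pos \<longleftrightarrow>
    b \<in> Field \<beta> \<and> c \<in> Field \<beta> \<and> (below \<beta> b c \<or> b = c \<and> i \<le> j)"
proof -
  have "((i, b), (j, c)) \<in> pos \<longleftrightarrow> below pos (i, b) (j, c) \<or> (i, b) = (j, c) \<and> (i, b) \<in> Field pos"
    using wo_refl[OF pos_wo] by (auto simp: below_def dest: FieldI1)
  then show ?thesis by (auto simp: below_pos Field_pos)
qed

sublocale P: long_tails pos
proof
  show "infinite {y. (x, y) \<in> pos}" if xF: "x \<in> Field pos" for x
  proof -
    obtain i b where x: "x = (i, b)" "b \<in> Field \<beta>" using xF Field_pos by auto
    have "infinite ((\<lambda>j. (j, b)) ` {i..})"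
      using infinite_Ici by (subst finite_image_iff) (auto simp: inj_on_def)
    moreover have "(\<lambda>j. (j, b)) ` {i..} \<subseteq> {y. (x, y) \<in> pos}"
      using x by (auto simp: le_pos)
    ultimately show ?thesis using finite_subset by blast
  qed
qed (rule pos_wo)

text \<open>Each block \<open>{(i, b) | i}\<close> is contained in one segment, as only finitely many positions separate
its elements.\<close>

lemma start_block:
  assumes b: "b \<in> Field \<beta>"
  shows "P.start (i, b) = P.start (0, b)"
proof -
  have F: "(j, b) \<in> Field pos" for j using b Field_pos by simp
  have le: "((0, b), (i, b)) \<in> pos" using b by (simp add: le_pos)
  have "P.gap (0, b) (i, b) \<subseteq> (\<lambda>j. (j, b)) ` {..<i}"
  proof
    fix q assume q: "q \<in> P.gap (0, b) (i, b)"
    obtain j c where jc: "q = (j, c)" by (cases q)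
    have "c = b \<and> j < i"
      using q below_not_le[OF \<beta>, of b c] below_in[of \<beta> c b] by (auto simp: jc P.gap_def le_pos below_pos)
    then show "q \<in> (\<lambda>j. (j, b)) ` {..<i}" using jc by simp
  qed
  then have "finite (P.gap (0, b) (i, b))" using finite_subset by blast
  then have "P.near (P.start (0, b)) (i, b)"
    using P.near_of_finite[OF le] P.near_trans P.near_start[OF F] by blast
  then have "(P.start (i, b), P.start (0, b)) \<in> pos" using P.start_least[OF F] by blast
  then show ?thesis using P.start_mono[OF le] wo_antisym[OF pos_wo] by blast
qed

definition nonzero :: "('b \<Rightarrow> nat) set"
  where "nonzero = {f \<in> oexp_carrier natLeq \<beta>. supp \<beta> f \<noteq> {}}"

definition low :: "('b \<Rightarrow> nat) \<Rightarrow> 'b" where "low f = wo_rel.minim \<beta> (supp \<beta> f)"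

lemma supp_Field: "supp \<beta> f \<subseteq> Field \<beta>"
  by (auto simp: supp_def)

lemma low:
  assumes "supp \<beta> f \<noteq> {}"
  shows low_in: "low f \<in> supp \<beta> f" and low_least: "c \<in> supp \<beta> f \<Longrightarrow> (low f, c) \<in> \<beta>"
  using wo_rel.minim_in[of \<beta>, OF _ supp_Field assms] wo_rel.minim_least[of \<beta>, OF _ supp_Field] \<beta>
  by (auto simp: low_def wo_rel_def)

text \<open>A function with finite support is coded by finitely many positions, the value \<open>i \<noteq> 0\<close> at the place
\<open>b\<close> by \<open>(i, b)\<close>.\<close>

definition entries :: "('b \<Rightarrow> nat) \<Rightarrow> (nat \<times> 'b) set"
  where "entries f = (\<lambda>b. (f b, b)) ` supp \<beta> f"

lemma entries_iff: "(i, b) \<in> entries f \<longleftrightarrow> b \<in> Field \<beta> \<and> f b = i \<and> i \<noteq> 0"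
  by (auto simp: entries_def supp_def)

lemma entries_inj:
  assumes "f \<in> oexp_carrier natLeq \<beta>" "g \<in> oexp_carrier natLeq \<beta>" "entries f = entries g"
  shows "f = g"
proof (rule fin_funs_eqI[OF assms(1,2)])
  fix b assume "b \<in> Field \<beta>"
  then show "f b = g b" using assms(3) entries_iff[of _ b] by metis
qed

lemma entries_finite: "f \<in> oexp_carrier natLeq \<beta> \<Longrightarrow> finite (entries f)"
  by (simp add: entries_def fin_funs_iff)

text \<open>A function is to be placed in the segment, named by its first position, that contains the block of
its least nonzero place.\<close>

definition base :: "('b \<Rightarrow> nat) \<Rightarrow> nat \<times> 'b" where "base f = P.start (0, low f)"

text \<open>Since all nonzero places are at or above \<open>low f\<close>, the entries outside the segment \<open>base f\<close> are those
above it.\<close>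

definition upper :: "('b \<Rightarrow> nat) \<Rightarrow> (nat \<times> 'b) set"
  where "upper f = {q \<in> entries f. P.start q \<noteq> base f}"

definition chain :: "nat \<times> 'b \<Rightarrow> (nat \<times> 'b) set \<times> nat \<Rightarrow> (('b \<Rightarrow> nat) \<times> nat) set"
  where "chain s u = {(f, k). f \<in> nonzero \<and> k \<le> n \<and> base f = s \<and> (upper f, k) = u}"

abbreviation \<theta> where "\<theta> \<equiv> (natLeq ^o \<beta>) *o natLeq_on (n + 1)"

lemma low_Field: "f \<in> nonzero \<Longrightarrow> low f \<in> Field \<beta>"
  using low_in supp_Field by (auto simp: nonzero_def)

lemma base_in_starts: "f \<in> nonzero \<Longrightarrow> \<exists>y\<in>Field pos. base f = P.start y"
  using low_Field Field_pos by (auto simp: base_def)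

text \<open>Let \<open>b\<close> be the largest nonzero place of \<open>f\<close> in the segment. The functions of the chain up to \<open>f\<close>
differ only in their entries within the segment, and these entries are at most \<open>(f b, b)\<close>. So each
function is determined by a finite subset of an initial part of the segment, which is small.\<close>

lemma chain_initial_small:
  assumes x: "(f, k) \<in> chain s u"
  shows "|{y \<in> chain s u. (y, (f, k)) \<in> \<theta>}| <o |P.segment s|"
proof -
  have f: "f \<in> nonzero" "f \<in> oexp_carrier natLeq \<beta>" "supp \<beta> f \<noteq> {}" "base f = s" "u = (upper f, k)"
    using x by (auto simp: chain_def nonzero_def)
  let ?M = "{c \<in> supp \<beta> f. P.start (0, c) = s}"
  have "low f \<in> ?M" using low_in[OF f(3)] f(4) by (simp add: base_def)
  then have "?M \<noteq> {}" by blast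
  moreover have "finite ?M" using f(2) by (simp add: fin_funs_iff)
  moreover have "?M \<subseteq> Field \<beta>" using supp_Field by blast
  ultimately obtain b where b: "b \<in> ?M" and greatest: "\<And>c. c \<in> ?M \<Longrightarrow> (c, b) \<in> \<beta>"
    using wo_greatest[OF \<beta>, of ?M] by blast
  have bF: "b \<in> Field \<beta>" using b supp_Field by blast
  let ?Q = "{q \<in> P.segment s. (q, (f b, b)) \<in> pos}"
  have "(f b, b) \<in> P.segment s"
    using b bF start_block[OF bF] by (simp add: P.segment_def Field_pos)
  then have "|?Q| <o |P.segment s|" by (rule P.segment_initial_small)
  moreover have "infinite (P.segment s)"
    using P.infinite_segment base_in_starts[OF f(1)] f(4) by auto
  ultimately have "|Fpow ?Q| <o |P.segment s|"
    using card_Fpow_ordLess by blast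
  moreover let ?Y = "{y \<in> chain s u. (y, (f, k)) \<in> \<theta>}"
  let ?part = "\<lambda>y. {q \<in> entries (fst y). P.start q = s}"
  have chain: "g \<in> nonzero \<and> g \<in> oexp_carrier natLeq \<beta> \<and> base g = s \<and> l = k \<and> upper g = upper f"
    if "(g, l) \<in> chain s u" for g l
    using that f by (auto simp: chain_def nonzero_def)
  have "?part y \<in> Fpow ?Q" if "y \<in> ?Y" for y
  proof -
    obtain g l where y: "y = (g, l)" by (cases y)
    have g: "g \<in> oexp_carrier natLeq \<beta>" "base g = s" "l = k" "upper g = upper f"
      using chain that y by auto
    have gf: "g = f \<or> below (natLeq ^o \<beta>) g f"
    proof (cases "(g, l) = (f, k)")
      case False
      then have "below \<theta> (g, l) (f, k)" using that y by (simp add: below_def)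
      then show ?thesis using g(3) by (simp only: below_power_times[OF \<beta>]) simp
    qed simp
    have "q \<in> ?Q" if q: "q \<in> ?part (g, l)" for q
    proof -
      obtain i c where ic: "q = (i, c)" by (cases q)
      have c: "c \<in> Field \<beta>" "g c = i" "i \<noteq> 0" "P.start (i, c) = s"
        using q ic by (auto simp: entries_iff)
      have f_bound: "(c, b) \<in> \<beta>" if "f c \<noteq> 0"
        using greatest[of c] c that start_block[OF c(1), of i] by (simp add: supp_def)
      have "((i, c), (f b, b)) \<in> pos"
      proof (cases "g = f")
        case True
        then show ?thesis using f_bound c bF by (auto simp: le_pos below_def)
      next
        case False
        then obtain d where d: "d \<in> Field \<beta>" "g d < f d" "\<And>e. below \<beta> d e \<Longrightarrow> g e = f e"
          using gf by (auto simp: below_oexp[OF \<beta>])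
        have "P.start (0, d) = s"
        proof (rule ccontr)
          assume ns: "P.start (0, d) \<noteq> s"
          then have "(f d, d) \<in> upper f"
            using d start_block[OF d(1), of "f d"] f(4) by (simp add: upper_def entries_iff)
          then have "(f d, d) \<in> upper g" using g(4) by simp
          then show False using d(2) by (simp add: upper_def entries_iff)
        qed
        then have db: "(d, b) \<in> \<beta>" using greatest[of d] d by (simp add: supp_def)
        consider "below \<beta> d c" | "c = d" | "below \<beta> c d" using below_total[OF \<beta> c(1) d(1)] by blast
        then show ?thesis
        proof cases
          case 1
          then have "g c = f c" by (rule d(3))
          then show ?thesis using f_bound c bF by (auto simp: le_pos below_def)
        next
          case 2
          then show ?thesis using db c d bF by (auto simp: le_pos below_def)
        next
          case 3
          then show ?thesis using below_le_trans[OF \<beta> 3 db] c bF by (simp add: le_pos)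
        qed
      qed
      then show ?thesis using c ic by (simp add: P.segment_def Field_pos)
    qed
    then show ?thesis using entries_finite[OF g(1)] y by (auto simp: Fpow_def)
  qed
  moreover have "inj_on ?part ?Y"
  proof (rule inj_onI)
    fix y y' assume y: "y \<in> ?Y" "y' \<in> ?Y" and eq: "?part y = ?part y'"
    obtain g l g' l' where gl: "y = (g, l)" "y' = (g', l')" by (cases y, cases y')
    have *: "g \<in> oexp_carrier natLeq \<beta>" "g' \<in> oexp_carrier natLeq \<beta>" "l = k" "l' = k"
      "base g = s" "base g' = s" "upper g = upper f" "upper g' = upper f"
      using chain y gl by auto
    have split: "entries h = {q \<in> entries h. P.start q = s} \<union> upper h" if "base h = s" for h
      using that by (auto simp: upper_def)
    have "entries g = entries g'" using * eq gl split[of g] split[of g'] by simp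
    then show "y = y'" using entries_inj * gl by blast
  qed
  ultimately have "|?Y| \<le>o |Fpow ?Q|"
    using card_of_ordLeq[of ?Y "Fpow ?Q"] by blast
  then show ?thesis using \<open>|Fpow ?Q| <o |P.segment s|\<close> ordLeq_ordLess_trans by blast
qed

text \<open>There are at most as many finite subsets of a tail as elements of the segment, because the segment
is infinite and has the size of the tail.\<close>

lemma copies_of_segment:
  assumes y: "y \<in> Field pos"
  shows "\<exists>c. inj_on c ((Fpow (P.tail (P.start y)) \<times> {..n}) \<times> P.segment (P.start y)) \<and>
    c ` ((Fpow (P.tail (P.start y)) \<times> {..n}) \<times> P.segment (P.start y)) \<subseteq> P.segment (P.start y)"
proof -
  let ?s = "P.start y"
  let ?S = "P.segment ?s"
  have inf: "infinite ?S" by (rule P.infinite_segment[OF y])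
  have "infinite (P.tail ?s)" using P.infinite_tail P.start_in[OF y] by blast
  then have A: "|Fpow (P.tail ?s)| \<le>o |?S|"
    using card_of_Fpow_infinite P.segment_large[OF y] ordIso_transitive ordIso_imp_ordLeq by blast
  have B: "|{..n}| \<le>o |?S|"
    using inf finite_ordLess_infinite2 ordLess_imp_ordLeq by blast
  have AB: "|Fpow (P.tail ?s) \<times> {..n}| \<le>o |?S|"
    by (rule card_of_Times_ordLeq_infinite_Field[OF _ A B]) (use inf in auto)
  have "|(Fpow (P.tail ?s) \<times> {..n}) \<times> ?S| \<le>o |?S|"
    by (rule card_of_Times_ordLeq_infinite_Field[OF _ AB]) (use inf in auto)
  then show ?thesis using card_of_ordLeq by blast
qed

text \<open>The chain with label \<open>u\<close> in the segment \<open>s\<close> is placed increasingly in the copy of \<open>s\<close> belonging to \<open>u\<close>.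
If the least place of \<open>g\<close> is below that of \<open>f\<close>, and \<open>g\<close>, \<open>f\<close> agree above the latter, then either the
two least places lie in different segments, so that \<open>g\<close> is placed in an earlier segment than
\<open>f\<close>, or \<open>g\<close> and \<open>f\<close> belong to the same chain.\<close>

lemma placement:
  "\<exists>\<phi>. (\<forall>x\<in>nonzero \<times> {..n}. \<phi> x \<in> Field pos) \<and> inj_on \<phi> (nonzero \<times> {..n}) \<and>
    (\<forall>f\<in>nonzero. \<forall>g\<in>nonzero. \<forall>k\<le>n. below (natLeq ^o \<beta>) g f \<longrightarrow> below \<beta> (low g) (low f) \<longrightarrow>
      (\<forall>c. below \<beta> (low f) c \<longrightarrow> g c = f c) \<longrightarrow> below pos (\<phi> (g, k)) (\<phi> (f, k)))"
proof -
  define starts where "starts = P.start ` Field pos"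
  have "\<forall>s\<in>starts. \<exists>c. inj_on c ((Fpow (P.tail s) \<times> {..n}) \<times> P.segment s) \<and>
      c ` ((Fpow (P.tail s) \<times> {..n}) \<times> P.segment s) \<subseteq> P.segment s"
    using copies_of_segment by (auto simp: starts_def)
  then obtain copy where copy: "\<And>s. s \<in> starts \<Longrightarrow>
      inj_on (copy s) ((Fpow (P.tail s) \<times> {..n}) \<times> P.segment s)"
    and copy_in: "\<And>s. s \<in> starts \<Longrightarrow>
      copy s ` ((Fpow (P.tail s) \<times> {..n}) \<times> P.segment s) \<subseteq> P.segment s"
    by metis
  define target where "target s u = (\<lambda>q. copy s (u, q)) ` P.segment s" for s u
  have target_sub: "target s u \<subseteq> P.segment s" if "s \<in> starts" "u \<in> Fpow (P.tail s) \<times> {..n}" for s u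
    using copy_in[OF that(1)] that(2) by (auto simp: target_def)
  define good where "good s u h \<longleftrightarrow> (\<forall>x\<in>chain s u. h x \<in> target s u) \<and>
      (\<forall>x\<in>chain s u. \<forall>y\<in>chain s u. below \<theta> x y \<longrightarrow> below pos (h x) (h y))" for s u h
  define h where "h s u = (SOME h. good s u h)" for s u
  have "\<exists>h. good s u h"
    if s: "s \<in> starts" and u: "u \<in> Fpow (P.tail s) \<times> {..n}" for s u
    unfolding good_def
  proof (rule chain_into_large_set[OF power_times_well_order(1)[OF \<beta>] pos_wo])
    show "chain s u \<subseteq> Field \<theta>"
      unfolding power_times_well_order(2)[OF \<beta>] by (auto simp: chain_def nonzero_def)
    show "target s u \<subseteq> Field pos" using target_sub[OF s u] by (auto simp: P.segment_def)
    have "inj_on (\<lambda>q. copy s (u, q)) (P.segment s)"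
    proof (rule inj_onI)
      fix q q' assume "q \<in> P.segment s" "q' \<in> P.segment s" "copy s (u, q) = copy s (u, q')"
      then show "q = q'" using inj_onD[OF copy[OF s], of "(u, q)" "(u, q')"] u by simp
    qed
    then have "|P.segment s| =o |target s u|"
      using card_of_ordIso unfolding target_def bij_betw_def by blast
    moreover fix x assume "x \<in> chain s u"
    then have "|{y \<in> chain s u. (y, x) \<in> \<theta>}| <o |P.segment s|"
      using chain_initial_small by (cases x) blast
    ultimately show "|{y \<in> chain s u. (y, x) \<in> \<theta>}| <o |target s u|"
      using ordLess_ordIso_trans by blast
  qed
  then have good_h: "good s u (h s u)" if "s \<in> starts" "u \<in> Fpow (P.tail s) \<times> {..n}" for s u
    unfolding h_def using someI_ex that by metis
  have h_in: "h s u x \<in> target s u"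
    if "s \<in> starts" "u \<in> Fpow (P.tail s) \<times> {..n}" "x \<in> chain s u" for s u x
    using good_h[OF that(1,2)] that(3) by (simp add: good_def)
  have h_mono: "below pos (h s u x) (h s u y)"
    if "s \<in> starts" "u \<in> Fpow (P.tail s) \<times> {..n}" "x \<in> chain s u" "y \<in> chain s u"
      "below \<theta> x y" for s u x y
    using good_h[OF that(1,2)] that(3-5) by (simp add: good_def)
  define \<phi> where "\<phi> x = h (base (fst x)) (upper (fst x), snd x) x" for x
  have start_in: "base f \<in> starts" if "f \<in> nonzero" for f
    using base_in_starts[OF that] by (auto simp: starts_def)
  have label_in: "(upper f, k) \<in> Fpow (P.tail (base f)) \<times> {..n}" if f: "f \<in> nonzero" "k \<le> n" for f k
  proof -
    have fin: "finite (upper f)"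
      using entries_finite f(1) by (auto simp: upper_def nonzero_def)
    have "(base f, q) \<in> pos" if "q \<in> entries f" for q
    proof -
      obtain i c where ic: "q = (i, c)" by (cases q)
      then have c: "c \<in> supp \<beta> f" "c \<in> Field \<beta>" using that by (auto simp: entries_iff supp_def)
      then have "(low f, c) \<in> \<beta>" using low_least f by (auto simp: nonzero_def)
      then have "((0, low f), (i, c)) \<in> pos"
        using low_Field[OF f(1)] c by (auto simp: le_pos below_def)
      moreover have "(base f, (0, low f)) \<in> pos"
        using P.start_le low_Field[OF f(1)] Field_pos by (simp add: base_def)
      ultimately show ?thesis using wo_trans[OF pos_wo] ic by blast
    qed
    then have "upper f \<subseteq> P.tail (base f)" by (auto simp: upper_def P.tail_def)
    then show ?thesis using fin f(2) by (simp add: Fpow_def)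
  qed
  have in_chain: "(f, k) \<in> chain (base f) (upper f, k)" if "f \<in> nonzero" "k \<le> n" for f k
    using that by (simp add: chain_def)
  have \<phi>_target: "\<phi> (f, k) \<in> target (base f) (upper f, k)" if "f \<in> nonzero" "k \<le> n" for f k
    using h_in[OF start_in label_in in_chain] that by (simp add: \<phi>_def)
  have \<phi>_seg: "\<phi> (f, k) \<in> P.segment (base f)" if "f \<in> nonzero" "k \<le> n" for f k
    using \<phi>_target[OF that] target_sub[OF start_in label_in] that by blast
  have \<phi>_mono: "below pos (\<phi> (g, k)) (\<phi> (f, k))"
    if "f \<in> nonzero" "g \<in> nonzero" "k \<le> n" "base g = base f" "upper g = upper f"
      "below (natLeq ^o \<beta>) g f" for f g k
  proof -
    have "below \<theta> (g, k) (f, k)"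
      unfolding below_power_times[OF \<beta>] using that by (simp add: nonzero_def)
    then show ?thesis
      using h_mono[OF start_in label_in _ in_chain, of f k "(g, k)"] in_chain[of g k] that
      by (simp add: \<phi>_def)
  qed
  have "inj_on \<phi> (nonzero \<times> {..n})"
  proof (rule inj_onI)
    fix x y assume x: "x \<in> nonzero \<times> {..n}" and y: "y \<in> nonzero \<times> {..n}" and "\<phi> x = \<phi> y"
    obtain f k g l where xy: "x = (f, k)" "y = (g, l)" by (cases x, cases y)
    have f: "f \<in> nonzero" "k \<in> {..n}" and g: "g \<in> nonzero" "l \<in> {..n}" and eq: "\<phi> (f, k) = \<phi> (g, l)"
      using x y xy \<open>\<phi> x = \<phi> y\<close> by auto
    have base: "base f = base g"
      using \<phi>_seg[of f k] \<phi>_seg[of g l] f g eq by (simp add: P.segment_def)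
    obtain q q' where q: "q \<in> P.segment (base f)" "q' \<in> P.segment (base f)"
      "\<phi> (f, k) = copy (base f) ((upper f, k), q)" "\<phi> (g, l) = copy (base f) ((upper g, l), q')"
      using \<phi>_target[of f k] \<phi>_target[of g l] f g base by (auto simp: target_def)
    have "((upper f, k), q) = ((upper g, l), q')"
      using inj_onD[OF copy[OF start_in[OF f(1)]], of "((upper f, k), q)" "((upper g, l), q')"]
        q eq label_in[of f k] label_in[of g l] f g base by simp
    then have up: "upper f = upper g" and k: "k = l" by auto
    have "\<not> below (natLeq ^o \<beta>) f g" "\<not> below (natLeq ^o \<beta>) g f"
      using \<phi>_mono[of f g k] \<phi>_mono[of g f k] f g base up k eq by auto
    then have "f = g"
      using well_order_on_Field[OF oexp_well_order[OF \<beta>]] below_total[of "natLeq ^o \<beta>" f g] f g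
      by (auto simp: nonzero_def)
    then show "x = y" using k xy by simp
  qed
  moreover have "below pos (\<phi> (g, k)) (\<phi> (f, k))"
    if f: "f \<in> nonzero" and g: "g \<in> nonzero" and k: "k \<le> n" and gf: "below (natLeq ^o \<beta>) g f"
      and low: "below \<beta> (low g) (low f)" and agree: "\<And>c. below \<beta> (low f) c \<Longrightarrow> g c = f c" for f g k
  proof -
    have lowF: "low f \<in> Field \<beta>" "low g \<in> Field \<beta>" using low_Field f g by auto
    have "((0, low g), (0, low f)) \<in> pos" using low lowF by (simp add: le_pos)
    then have base_le: "(base g, base f) \<in> pos" unfolding base_def by (rule P.start_mono)
    show ?thesis
    proof (cases "base g = base f")
      case True
      have same: "(i, c) \<in> entries g \<longleftrightarrow> (i, c) \<in> entries f" if c: "c \<in> Field \<beta>" "P.start (i, c) \<noteq> base f" for i c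
      proof (cases "below \<beta> (low f) c")
        case True
        then show ?thesis using agree by (simp add: entries_iff)
      next
        case False
        then have cf: "(c, low f) \<in> \<beta>" using not_below_iff[OF \<beta> lowF(1) c(1)] by simp
        have "\<not> (low g, c) \<in> \<beta>"
        proof
          assume gc: "(low g, c) \<in> \<beta>"
          have "((0, low g), (0, c)) \<in> pos" "((0, c), (0, low f)) \<in> pos"
            using gc cf c lowF by (auto simp: le_pos below_def)
          then have "P.start (0, c) = base f"
            using P.start_mono wo_antisym[OF pos_wo] True unfolding base_def by metis
          then show False using c start_block[OF c(1)] by simp
        qed
        then have "c \<notin> supp \<beta> g" "c \<notin> supp \<beta> f"
          using low_least[of g c] low_least[of f c] f g wo_trans[OF \<beta> below_in[OF low]]
          by (auto simp: nonzero_def)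
        then show ?thesis using c by (auto simp: entries_iff supp_def)
      qed
      have "q \<in> upper g \<longleftrightarrow> q \<in> upper f" for q
      proof -
        obtain i c where q: "q = (i, c)" by (cases q)
        show ?thesis
        proof (cases "c \<in> Field \<beta> \<and> P.start (i, c) \<noteq> base f")
          case True
          then show ?thesis using same \<open>base g = base f\<close> by (simp add: upper_def q)
        next
          case False
          then show ?thesis using \<open>base g = base f\<close> by (auto simp: upper_def q entries_iff)
        qed
      qed
      then have "upper g = upper f" by blast
      then show ?thesis using \<phi>_mono f g k True gf by blast
    next
      case False
      have *: "\<phi> (f, k) \<in> Field pos" "P.start (\<phi> (f, k)) = base f"
        "\<phi> (g, k) \<in> Field pos" "P.start (\<phi> (g, k)) = base g"
        using \<phi>_seg[OF f k] \<phi>_seg[OF g k] by (auto simp: P.segment_def)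
      then have "(\<phi> (f, k), \<phi> (g, k)) \<notin> pos"
        using P.start_mono[of "\<phi> (f, k)" "\<phi> (g, k)"] base_le False wo_antisym[OF pos_wo] by metis
      then show ?thesis using not_below_iff[OF pos_wo *(3,1)] by blast
    qed
  qed
  moreover have "\<forall>x\<in>nonzero \<times> {..n}. \<phi> x \<in> Field pos"
    using \<phi>_seg by (auto simp: P.segment_def)
  ultimately show ?thesis by blast
qed

definition dec :: "('b \<Rightarrow> nat) \<Rightarrow> 'b \<Rightarrow> nat" where "dec f = f(low f := f (low f) - 1)"

lemma below_dec:
  assumes f: "f \<in> nonzero"
  shows "below (natLeq ^o \<beta>) (dec f) f"
proof -
  have fc: "f \<in> oexp_carrier natLeq \<beta>" and l: "low f \<in> Field \<beta>" "f (low f) \<noteq> 0"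
    using f low_in[of f] by (auto simp: nonzero_def supp_def)
  have "supp \<beta> (dec f) \<subseteq> supp \<beta> f" by (auto simp: supp_def dec_def)
  then have "dec f \<in> oexp_carrier natLeq \<beta>"
    using fc l finite_subset by (auto simp: fin_funs_iff dec_def)
  then show ?thesis
    using fc l by (auto simp: below_oexp[OF \<beta>] dec_def intro!: bexI[of _ "low f"])
qed

text \<open>At the largest place where \<open>g\<close> and \<open>f\<close> differ, \<open>f\<close> is not \<open>0\<close>, so this place is at or above
\<open>low f\<close>; it is not above, as \<open>g\<close> would then be below \<open>dec f\<close>, too. At \<open>low f\<close> the value of \<open>g\<close> must be that of
\<open>dec f\<close>, so \<open>g\<close> exceeds \<open>dec f\<close> at some lower place, where its value is not \<open>0\<close>.\<close>

lemma between_dec: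
  assumes f: "f \<in> nonzero" and lower: "below (natLeq ^o \<beta>) (dec f) g" and upper: "below (natLeq ^o \<beta>) g f"
  shows "g \<in> nonzero \<and> below \<beta> (low g) (low f) \<and> (\<forall>c. below \<beta> (low f) c \<longrightarrow> g c = f c)"
proof -
  let ?b = "low f"
  have bF: "?b \<in> Field \<beta>" by (rule low_Field[OF f])
  obtain d where g: "g \<in> oexp_carrier natLeq \<beta>"
    and d: "d \<in> Field \<beta>" "g d < f d" "\<And>c. below \<beta> d c \<Longrightarrow> g c = f c"
    using upper by (auto simp: below_oexp[OF \<beta>])
  obtain e where e: "e \<in> Field \<beta>" "dec f e < g e" "\<And>c. below \<beta> e c \<Longrightarrow> dec f c = g c"
    using lower by (auto simp: below_oexp[OF \<beta>])
  have dec_above: "dec f c = f c" if "below \<beta> ?b c" for c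
    using that by (auto simp: dec_def)
  have bd: "(?b, d) \<in> \<beta>"
    using low_least[of f d] f d by (simp add: nonzero_def supp_def)
  have "\<not> below \<beta> ?b d"
  proof
    assume "below \<beta> ?b d"
    then have dd: "dec f d = f d" by (rule dec_above)
    consider "below \<beta> e d" | "e = d" | "below \<beta> d e" using below_total[OF \<beta> e(1) d(1)] by blast
    then show False
    proof cases
      case 3
      then show False using d(3)[OF 3] e(2) dec_above[OF le_below_trans[OF \<beta> bd 3]] by simp
    qed (use e d dd in auto)
  qed
  then have db: "d = ?b" using bd by (simp add: below_def)
  have eb: "below \<beta> e ?b"
  proof -
    consider "below \<beta> e ?b" | "e = ?b" | "below \<beta> ?b e" using below_total[OF \<beta> e(1) bF] by blast
    then show ?thesis
    proof cases
      case 2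
      then show ?thesis using e(2) d(2) db by (simp add: dec_def)
    next
      case 3
      then show ?thesis using d(3) e(2) dec_above[OF 3] db by simp
    qed
  qed
  have "e \<in> supp \<beta> g" using e by (simp add: supp_def)
  then have "g \<in> nonzero" "(low g, e) \<in> \<beta>" using g low_least[of g e] by (auto simp: nonzero_def)
  then show ?thesis using le_below_trans[OF \<beta> _ eb] d(3) db by blast
qed

definition zero_fun :: "'b \<Rightarrow> nat" where "zero_fun b = (if b \<in> Field \<beta> then 0 else undefined)"

lemma zero_fun: "zero_fun \<in> oexp_carrier natLeq \<beta>" "zero_fun \<notin> nonzero"
proof -
  have "supp \<beta> zero_fun = {}" by (auto simp: supp_def zero_fun_def)
  then show "zero_fun \<in> oexp_carrier natLeq \<beta>" "zero_fun \<notin> nonzero"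
    by (auto simp: fin_funs_iff nonzero_def zero_fun_def)
qed

lemma not_nonzero: "f \<in> oexp_carrier natLeq \<beta> \<Longrightarrow> f \<notin> nonzero \<Longrightarrow> f = zero_fun"
  using zero_fun by (intro fin_funs_eqI[of f \<beta>]) (auto simp: nonzero_def supp_def zero_fun_def)

lemma not_below_zero_fun: "\<not> below (natLeq ^o \<beta>) f zero_fun"
  by (auto simp: below_oexp[OF \<beta>] zero_fun_def)

lemma Field_\<theta>: "(f, k) \<in> Field \<theta> \<longleftrightarrow> (f \<in> nonzero \<or> f = zero_fun) \<and> k \<le> n"
proof -
  have "nonzero \<subseteq> oexp_carrier natLeq \<beta>" by (auto simp: nonzero_def)
  then have "f \<in> oexp_carrier natLeq \<beta> \<longleftrightarrow> f \<in> nonzero \<or> f = zero_fun"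
    using not_nonzero[of f] zero_fun(1) by blast
  then show ?thesis unfolding power_times_well_order(2)[OF \<beta>] by simp
qed

text \<open>A copy of \<open>0\<close>, other than the first, is reached from the previous copy of \<open>0\<close>.\<close>

definition par :: "('b \<Rightarrow> nat) \<times> nat \<Rightarrow> ('b \<Rightarrow> nat) \<times> nat"
  where "par = (\<lambda>(f, k). if f \<in> nonzero then (dec f, k) else (f, k - 1))"

text \<open>The \<open>n\<close> topmost vertices serve as the zeros of the copies of \<open>\<omega>\<^sup>\<beta>\<close> after the first one; being the
largest, they are visited only when no other vertex is available.\<close>

lemma long_traversal_exists:
  fixes \<alpha> :: "'a rel"
  assumes \<alpha>: "Well_order \<alpha>" and inf: "infinite (Field \<alpha>)"
    and iso: "\<alpha> =o (natLeq *o \<beta>) +o natLeq_on n"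
  shows "\<exists>E. wellordered_connected_graph (Field \<alpha>) E \<alpha> \<and> \<theta> \<le>o traversal (Field \<alpha>) E \<alpha>"
proof -
  let ?\<sigma> = "pos +o natLeq_on n"
  note sum = well_order_on_Field[OF osum_well_order[OF pos_wo natLeq_on_Well_order[of n]]]
  have sumF: "Field ?\<sigma> = (UNIV \<times> Field \<beta>) <+> {x. x < n}"
    using sum Field_pos by (simp add: Field_natLeq_on)
  obtain g where g: "bij_betw g (Field ?\<sigma>) (Field \<alpha>)"
    and g_le: "\<forall>x\<in>Field ?\<sigma>. \<forall>y\<in>Field ?\<sigma>. (g x, g y) \<in> \<alpha> \<longleftrightarrow> (x, y) \<in> ?\<sigma>"
    and g_less: "\<forall>x\<in>Field ?\<sigma>. \<forall>y\<in>Field ?\<sigma>. below \<alpha> (g x) (g y) \<longleftrightarrow> below ?\<sigma> x y"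
    using ordIso_bij[OF ordIso_symmetric[OF iso, folded pos_def]] by blast
  have "Field \<beta> \<noteq> {}"
  proof
    assume "Field \<beta> = {}"
    then have "finite (Field ?\<sigma>)" using sumF by simp
    then show False using g inf bij_betw_finite by blast
  qed
  then obtain b0 where b0: "b0 \<in> Field \<beta>" "\<forall>b\<in>Field \<beta>. (b0, b) \<in> \<beta>"
    using wo_least[OF \<beta>, of "Field \<beta>"] by blast
  obtain \<phi> where \<phi>_in: "\<forall>x\<in>nonzero \<times> {..n}. \<phi> x \<in> Field pos" and \<phi>_inj: "inj_on \<phi> (nonzero \<times> {..n})"
    and \<phi>_mono: "\<And>f g k. f \<in> nonzero \<Longrightarrow> g \<in> nonzero \<Longrightarrow> k \<le> n \<Longrightarrow> below (natLeq ^o \<beta>) g f \<Longrightarrow>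
      below \<beta> (low g) (low f) \<Longrightarrow> (\<forall>c. below \<beta> (low f) c \<longrightarrow> g c = f c) \<Longrightarrow>
      below pos (\<phi> (g, k)) (\<phi> (f, k))"
    using placement by blast
  \<comment> \<open>Moving up by one within the block keeps the first position free for the root.\<close>
  define shift where "shift = (\<lambda>(i :: nat, b :: 'b). (Suc i, b))"
  define \<psi> where "\<psi> = (\<lambda>(f, k). if f \<in> nonzero then Inl (shift (\<phi> (f, k)))
      else if k = 0 then Inl (0, b0) else Inr (k - 1))"
  have \<psi>_in: "\<psi> x \<in> Field ?\<sigma>" if "x \<in> Field \<theta>" for x
  proof -
    obtain f k where x: "x = (f, k)" by (cases x)
    then have k: "k \<le> n" and "f \<in> nonzero \<Longrightarrow> \<phi> (f, k) \<in> Field pos"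
      using that Field_\<theta> \<phi>_in by auto
    then show ?thesis
      using b0 unfolding sumF by (auto simp: x \<psi>_def shift_def Field_pos)
  qed
  have \<psi>_inj: "inj_on \<psi> (Field \<theta>)"
  proof (rule inj_onI)
    fix x y assume F: "x \<in> Field \<theta>" "y \<in> Field \<theta>" and eq: "\<psi> x = \<psi> y"
    obtain f k f' k' where xy: "x = (f, k)" "y = (f', k')" by (cases x, cases y)
    have mem: "f \<in> nonzero \<or> f = zero_fun" "f' \<in> nonzero \<or> f' = zero_fun" "k \<le> n" "k' \<le> n"
      using F Field_\<theta> xy by auto
    show "x = y"
    proof (cases "f \<in> nonzero \<and> f' \<in> nonzero")
      case True
      then have "\<phi> (f, k) = \<phi> (f', k')"
        using eq by (auto simp: \<psi>_def xy shift_def split: prod.splits)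
      then show ?thesis using inj_onD[OF \<phi>_inj, of "(f, k)" "(f', k')"] True mem xy by simp
    next
      case False
      then show ?thesis
        using eq mem by (auto simp: \<psi>_def xy shift_def split: if_splits prod.splits)
    qed
  qed
  let ?G = "g \<circ> \<psi>"
  show ?thesis
  proof (rule traversal_of_parents[where G = ?G and org = "(zero_fun, 0)" and par = par])
    show "Well_order \<alpha>" "infinite (Field \<alpha>)" by fact+
    show "Well_order \<theta>" by (rule power_times_well_order(1)[OF \<beta>])
    show "(zero_fun, 0) \<in> Field \<theta>" unfolding Field_\<theta> by simp
    show "inj_on ?G (Field \<theta>)"
      using \<psi>_inj \<psi>_in g by (auto simp: bij_betw_def inj_on_def)
    show "?G ` Field \<theta> \<subseteq> Field \<alpha>"
      using \<psi>_in g by (auto simp: bij_betw_def)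
    show "(?G (zero_fun, 0), v) \<in> \<alpha>" if vF: "v \<in> Field \<alpha>" for v
    proof -
      obtain q where q: "q \<in> Field ?\<sigma>" "v = g q" using g vF by (auto simp: bij_betw_def)
      have "(Inl (0, b0), q) \<in> ?\<sigma>"
      proof (cases q)
        case (Inl a)
        then obtain i b where a: "a = (i, b)" "b \<in> Field \<beta>" using q(1) unfolding sumF by auto
        then have "((0, b0), (i, b)) \<in> pos" using b0 by (auto simp: le_pos below_def)
        then show ?thesis using Inl a by (simp add: osum_def)
      next
        case (Inr k)
        then show ?thesis using q(1) b0 Field_pos Field_natLeq_on[of n] unfolding sumF by (auto simp: osum_def)
      qed
      then show ?thesis
        using g_le \<psi>_in[of "(zero_fun, 0)"] q zero_fun Field_\<theta>[of zero_fun 0] by (simp add: \<psi>_def)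
    qed
    fix y assume y: "y \<in> Field \<theta>" "y \<noteq> (zero_fun, 0)"
    obtain f k where fk: "y = (f, k)" by (cases y)
    have mem: "f \<in> nonzero \<or> f = zero_fun \<and> k \<noteq> 0" "k \<le> n" using y fk Field_\<theta> by auto
    show "below \<theta> (par y) y"
    proof (cases "f \<in> nonzero")
      case True
      then have "below (natLeq ^o \<beta>) (dec f) f" by (rule below_dec)
      then have "below \<theta> (dec f, k) (f, k)"
        unfolding below_power_times[OF \<beta>] using mem(2) by (auto simp: below_oexp[OF \<beta>])
      then show ?thesis using True by (simp add: fk par_def)
    next
      case False
      then have "below \<theta> (f, k - 1) (f, k)"
        unfolding below_power_times[OF \<beta>] using mem zero_fun by auto
      then show ?thesis using False by (simp add: fk par_def)
    qed
    show "below \<alpha> (?G x) (?G y)" if px: "below \<theta> (par y) x" and xy: "below \<theta> x y" for x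
    proof -
      obtain f' l where x: "x = (f', l)" by (cases x)
      have xF: "x \<in> Field \<theta>" using below_Field[OF xy] by simp
      note xy' = xy[unfolded x fk below_power_times[OF \<beta>]]
      have "below ?\<sigma> (\<psi> x) (\<psi> y)"
      proof (cases "f \<in> nonzero")
        case True
        then have "par y = (dec f, k)" by (simp add: fk par_def)
        then have px': "k < l \<or> k = l \<and> below (natLeq ^o \<beta>) (dec f) f'"
          using px unfolding x by (simp only: below_power_times[OF \<beta>])
        then have l: "l = k" and between: "below (natLeq ^o \<beta>) (dec f) f'" "below (natLeq ^o \<beta>) f' f"
          using xy' by auto
        have f': "f' \<in> nonzero" "below \<beta> (low f') (low f)" "\<forall>c. below \<beta> (low f) c \<longrightarrow> f' c = f c"
          using between_dec[OF True between] by auto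
        have "below pos (\<phi> (f', k)) (\<phi> (f, k))"
          by (rule \<phi>_mono[OF True f'(1) mem(2) between(2) f'(2,3)])
        then have "below pos (shift (\<phi> (f', k))) (shift (\<phi> (f, k)))"
          by (auto simp: shift_def below_pos split: prod.splits)
        then show ?thesis
          using True f' by (simp add: x fk l \<psi>_def below_osum[OF pos_wo natLeq_on_Well_order])
      next
        case False
        then have f: "f = zero_fun" "k \<noteq> 0" using mem by auto
        then have "par y = (zero_fun, k - 1)" using False by (simp add: fk par_def)
        then have px': "k - 1 < l \<or> k - 1 = l \<and> below (natLeq ^o \<beta>) zero_fun f'"
          using px unfolding x by (simp only: below_power_times[OF \<beta>])
        have "l < k" using xy' f not_below_zero_fun by auto
        then have l: "l = k - 1" "f' \<noteq> zero_fun" using px' not_below_zero_fun by auto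
        then have f': "f' \<in> nonzero" using xF Field_\<theta> x by auto
        then have "\<phi> (f', l) \<in> Field pos" using \<phi>_in xF Field_\<theta> x by auto
        then have "shift (\<phi> (f', l)) \<in> Field pos" by (auto simp: shift_def Field_pos split: prod.splits)
        then show ?thesis
          using f' f zero_fun mem(2)
          by (auto simp: x fk \<psi>_def below_osum[OF pos_wo natLeq_on_Well_order] Field_natLeq_on)
      qed
      then show ?thesis using g_less \<psi>_in[OF xF] \<psi>_in[OF y(1)] by simp
    qed
  qed
qed

end


section \<open>Writing an ordinal as \<open>\<omega> \<cdot> \<beta> + n\<close>\<close>

text \<open>In \<open>\<omega> \<cdot> \<beta> + n\<close> the late elements are the last \<open>n\<close> ones, and the limits among the others are the first
elements of the \<open>\<beta>\<close> many copies of \<open>\<omega>\<close>; zero counts as a limit.\<close>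

definition late :: "'a rel \<Rightarrow> 'a set"
  where "late r = {x \<in> Field r. finite {y. below r x y}}"

definition limits :: "'a rel \<Rightarrow> 'a set"
  where "limits r = {x \<in> Field r - late r. \<forall>y. below r y x \<longrightarrow> (\<exists>z. below r y z \<and> below r z x)}"

lemma late_limits_transport:
  assumes g: "bij_betw g (Field s) (Field r)"
    and g_less: "\<And>x y. x \<in> Field s \<Longrightarrow> y \<in> Field s \<Longrightarrow> below r (g x) (g y) \<longleftrightarrow> below s x y"
  shows "late r = g ` late s" "limits r = g ` limits s"
proof -
  have inj: "inj_on g (Field s)" and onto: "Field r = g ` Field s" using g by (auto simp: bij_betw_def)
  have above: "{y. below r (g x) y} = g ` {y. below s x y}" if x: "x \<in> Field s" for x
  proof
    show "{y. below r (g x) y} \<subseteq> g ` {y. below s x y}"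
    proof
      fix y assume "y \<in> {y. below r (g x) y}"
      then have y: "below r (g x) y" by simp
      then obtain y' where "y' \<in> Field s" "y = g y'" using below_Field[OF y] onto by blast
      then show "y \<in> g ` {y. below s x y}" using y g_less x by blast
    qed
    show "g ` {y. below s x y} \<subseteq> {y. below r (g x) y}"
      using g_less x below_Field[of s x] by blast
  qed
  have fin: "finite {y. below r (g x) y} \<longleftrightarrow> finite {y. below s x y}" if "x \<in> Field s" for x
    unfolding above[OF that]
    by (rule finite_image_iff, rule inj_on_subset[OF inj]) (use below_Field[of s] in blast)
  show late: "late r = g ` late s"
    using fin unfolding late_def onto by blast
  have dense: "(\<forall>y. below r y (g x) \<longrightarrow> (\<exists>z. below r y z \<and> below r z (g x))) \<longleftrightarrow>
      (\<forall>y. below s y x \<longrightarrow> (\<exists>z. below s y z \<and> below s z x))" (is "?L \<longleftrightarrow> ?R")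
    if x: "x \<in> Field s" for x
  proof
    assume L: ?L
    show ?R
    proof (intro allI impI)
      fix y assume y: "below s y x"
      then have yF: "y \<in> Field s" using below_Field by metis
      then obtain z where z: "below r (g y) z" "below r z (g x)" using L y g_less x by metis
      then obtain z' where "z' \<in> Field s" "z = g z'" using below_Field[OF z(1)] onto by blast
      then show "\<exists>z. below s y z \<and> below s z x" using z g_less x yF by metis
    qed
  next
    assume R: ?R
    show ?L
    proof (intro allI impI)
      fix y assume y: "below r y (g x)"
      then obtain y' where y': "y' \<in> Field s" "y = g y'" using below_Field[OF y] onto by blast
      then obtain z where z: "below s y' z" "below s z x" using R y g_less x by metis
      then show "\<exists>z. below r y z \<and> below r z (g x)"
        using y' g_less x below_Field[OF z(1)] by metis
    qed
  qed
  have "g x \<in> late r \<longleftrightarrow> x \<in> late s" if "x \<in> Field s" for x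
    using fin[OF that] that onto by (simp add: late_def)
  then show "limits r = g ` limits s"
    using dense unfolding limits_def onto by blast
qed

lemma decomposition_invariants:
  fixes \<beta> :: "'b rel" and \<alpha> :: "'a rel"
  assumes \<beta>: "Well_order \<beta>" and iso: "\<alpha> =o (natLeq *o \<beta>) +o natLeq_on n"
  shows "n = card (late \<alpha>)" "\<beta> =o Restr \<alpha> (limits \<alpha>)"
proof -
  interpret P: power_placement \<beta> n by unfold_locales (rule \<beta>)
  let ?\<sigma> = "P.pos +o natLeq_on n"
  note sum = well_order_on_Field[OF osum_well_order[OF P.pos_wo natLeq_on_Well_order[of n]]]
  have F: "Field ?\<sigma> = (UNIV \<times> Field \<beta>) <+> {x. x < n}"
    using sum P.Field_pos by (simp add: Field_natLeq_on)
  note less = below_osum[OF P.pos_wo natLeq_on_Well_order[of n]]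
  have \<alpha>: "Well_order \<alpha>" using iso ordIso_Well_order_simp by blast
  have less_LL: "below ?\<sigma> (Inl (i, b)) (Inl (j, c)) \<longleftrightarrow>
      b \<in> Field \<beta> \<and> c \<in> Field \<beta> \<and> (below \<beta> b c \<or> b = c \<and> i < j)" for i b j c
    by (simp add: less P.below_pos)
  have late: "late ?\<sigma> = Inr ` {..<n}"
  proof -
    have "infinite {y. below ?\<sigma> (Inl (i, b)) y}" if b: "b \<in> Field \<beta>" for i b
    proof -
      have "infinite ((\<lambda>j. Inl (j, b) :: (nat \<times> 'b) + nat) ` {i<..})"
        using infinite_Ioi by (subst finite_image_iff) (auto simp: inj_on_def)
      moreover have "(\<lambda>j. Inl (j, b)) ` {i<..} \<subseteq> {y. below ?\<sigma> (Inl (i, b)) y}"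
        using b by (auto simp: less_LL)
      ultimately show ?thesis using finite_subset by blast
    qed
    moreover have "finite {y. below ?\<sigma> (Inr k) y}" for k
    proof (rule finite_subset)
      show "{y. below ?\<sigma> (Inr k) y} \<subseteq> Inr ` {..<n}"
      proof
        fix y assume "y \<in> {y. below ?\<sigma> (Inr k) y}"
        then show "y \<in> Inr ` {..<n}" by (cases y) (auto simp: less below_natLeq_on)
      qed
    qed simp
    ultimately show ?thesis unfolding late_def F by auto
  qed
  have limits: "limits ?\<sigma> = (\<lambda>b. Inl (0, b)) ` Field \<beta>"
  proof
    show "limits ?\<sigma> \<subseteq> (\<lambda>b. Inl (0, b)) ` Field \<beta>"
    proof
      fix x assume x: "x \<in> limits ?\<sigma>"
      then obtain i b where ib: "x = Inl (i, b)" "b \<in> Field \<beta>"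
        using late unfolding limits_def F by auto
      have "i = 0"
      proof (rule ccontr)
        assume "i \<noteq> 0"
        then have "below ?\<sigma> (Inl (i - 1, b)) x" using ib by (simp add: less_LL)
        then obtain z where z: "below ?\<sigma> (Inl (i - 1, b)) z" "below ?\<sigma> z (Inl (i, b))"
          using x ib unfolding limits_def by blast
        then obtain j c where "z = Inl (j, c)" by (cases z) (auto simp: less)
        then show False using z below_not_le[OF \<beta>, of b c] below_in[of \<beta> c b]
          by (auto simp: less_LL)
      qed
      then show "x \<in> (\<lambda>b. Inl (0, b)) ` Field \<beta>" using ib by simp
    qed
    show "(\<lambda>b. Inl (0, b)) ` Field \<beta> \<subseteq> limits ?\<sigma>"
    proof clarify
      fix b assume b: "b \<in> Field \<beta>"
      have "\<exists>z. below ?\<sigma> y z \<and> below ?\<sigma> z (Inl (0, b))" if y: "below ?\<sigma> y (Inl (0, b))" for y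
      proof -
        obtain j c where jc: "y = Inl (j, c)" using y by (cases y) (auto simp: less)
        then show ?thesis using y by (intro exI[of _ "Inl (Suc j, c)"]) (auto simp: less_LL)
      qed
      then show "Inl (0, b) \<in> limits ?\<sigma>"
        unfolding limits_def late F using b by auto
    qed
  qed
  obtain g where g: "bij_betw g (Field ?\<sigma>) (Field \<alpha>)"
    and g_less: "\<forall>x\<in>Field ?\<sigma>. \<forall>y\<in>Field ?\<sigma>. below \<alpha> (g x) (g y) \<longleftrightarrow> below ?\<sigma> x y"
    using ordIso_bij[OF ordIso_symmetric[OF iso, folded P.pos_def]] by blast
  have inj: "inj_on g (Field ?\<sigma>)" using g by (simp add: bij_betw_def)
  have late_\<alpha>: "late \<alpha> = g ` late ?\<sigma>" and limits_\<alpha>: "limits \<alpha> = g ` limits ?\<sigma>"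
    using late_limits_transport[OF g] g_less by blast+
  have "inj_on g (late ?\<sigma>)" by (rule inj_on_subset[OF inj]) (auto simp: late_def)
  then show "n = card (late \<alpha>)" unfolding late_\<alpha> by (simp add: card_image late)
  have base_in: "Inl (0, b) \<in> Field ?\<sigma>" if "b \<in> Field \<beta>" for b using that unfolding F by auto
  show "\<beta> =o Restr \<alpha> (limits \<alpha>)"
  proof (rule strict_bij_imp_ordIso[where f = "\<lambda>b. g (Inl (0, b))"])
    have "Field (Restr \<alpha> (limits \<alpha>)) = limits \<alpha>"
      by (rule Field_Restr_Well_order[OF \<alpha>]) (auto simp: limits_def)
    then have "Field (Restr \<alpha> (limits \<alpha>)) = (\<lambda>b. g (Inl (0, b))) ` Field \<beta>"
      by (simp add: limits_\<alpha> limits image_image)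
    moreover have "inj_on (\<lambda>b. g (Inl (0, b))) (Field \<beta>)"
      using inj base_in unfolding inj_on_def by blast
    ultimately show "bij_betw (\<lambda>b. g (Inl (0, b))) (Field \<beta>) (Field (Restr \<alpha> (limits \<alpha>)))"
      by (simp add: bij_betw_def)
    show "below (Restr \<alpha> (limits \<alpha>)) (g (Inl (0, b))) (g (Inl (0, c)))" if bc: "below \<beta> b c" for b c
      using below_Field[OF bc] bc g_less base_in
      by (auto simp: below_Restr limits_\<alpha> limits less_LL)
  qed (use \<beta> Well_order_Restr[OF \<alpha>] in auto)
qed

text \<open>All late elements but the least one are above the least one.\<close>

lemma finite_late:
  assumes \<alpha>: "Well_order \<alpha>"
  shows "finite (late \<alpha>)"
proof (cases "late \<alpha> = {}")
  case False
  have "late \<alpha> \<subseteq> Field \<alpha>" by (auto simp: late_def)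
  then obtain m where m: "m \<in> late \<alpha>" "\<forall>x\<in>late \<alpha>. (m, x) \<in> \<alpha>"
    using wo_least[OF \<alpha> _ False] by blast
  then have "late \<alpha> \<subseteq> insert m {y. below \<alpha> m y}" by (auto simp: below_def)
  then show ?thesis using m finite_subset by (auto simp: late_def)
qed simp

text \<open>Going down from an element that is not late, one reaches a limit after finitely many steps from
successor to predecessor; and from a limit that is not late, all finite iterates of the successor
exist and stay below the next limit.\<close>

lemma decomposition_exists:
  fixes \<alpha> :: "'a rel"
  assumes \<alpha>: "Well_order \<alpha>"
  shows "\<alpha> =o (natLeq *o Restr \<alpha> (limits \<alpha>)) +o natLeq_on (card (late \<alpha>))"
proof -
  let ?\<beta> = "Restr \<alpha> (limits \<alpha>)" and ?n = "card (late \<alpha>)"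
  have \<beta>: "Well_order ?\<beta>" by (rule Well_order_Restr[OF \<alpha>])
  have \<beta>F: "Field ?\<beta> = limits \<alpha>" by (rule Field_Restr_Well_order[OF \<alpha>]) (auto simp: limits_def)
  interpret P: power_placement ?\<beta> ?n by unfold_locales (rule \<beta>)
  let ?\<sigma> = "P.pos +o natLeq_on ?n"
  note sum = well_order_on_Field[OF osum_well_order[OF P.pos_wo natLeq_on_Well_order[of ?n]]]
  have F: "Field ?\<sigma> = (UNIV \<times> limits \<alpha>) <+> {x. x < ?n}"
    using sum P.Field_pos \<beta>F by (simp add: Field_natLeq_on)
  note less = below_osum[OF P.pos_wo natLeq_on_Well_order[of ?n]]
  define early where "early = Field \<alpha> - late \<alpha>"
  have early_above: "infinite {y. below \<alpha> x y}" if "x \<in> early" for x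
    using that by (auto simp: early_def late_def)
  have early_down: "y \<in> early" if yx: "below \<alpha> y x" and x: "x \<in> early" for x y
  proof -
    have "{z. below \<alpha> x z} \<subseteq> {z. below \<alpha> y z}" using below_trans[OF \<alpha> yx] by blast
    then show ?thesis
      using early_above[OF x] below_Field[OF yx] finite_subset by (auto simp: early_def late_def)
  qed
  have nxt_ex: "\<exists>y. below \<alpha> x y \<and> (\<forall>z. below \<alpha> x z \<longrightarrow> (y, z) \<in> \<alpha>)" if x: "x \<in> early" for x
  proof -
    have "{y. below \<alpha> x y} \<subseteq> Field \<alpha>" using below_Field[of \<alpha> x] by blast
    moreover have "{y. below \<alpha> x y} \<noteq> {}" using early_above[OF x] by (metis finite.emptyI)
    ultimately show ?thesis using wo_least[OF \<alpha>, of "{y. below \<alpha> x y}"] by blast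
  qed
  define nxt where "nxt x = (SOME y. below \<alpha> x y \<and> (\<forall>z. below \<alpha> x z \<longrightarrow> (y, z) \<in> \<alpha>))" for x
  have nxt: "below \<alpha> x (nxt x)" "\<And>z. below \<alpha> x z \<Longrightarrow> (nxt x, z) \<in> \<alpha>" if "x \<in> early" for x
    using someI_ex[OF nxt_ex[OF that]] by (auto simp: nxt_def)
  have nxt_early: "nxt x \<in> early" if x: "x \<in> early" for x
  proof -
    have "{z. below \<alpha> x z} \<subseteq> insert (nxt x) {z. below \<alpha> (nxt x) z}"
      using nxt(2)[OF x] by (auto simp: below_def)
    then have "infinite {z. below \<alpha> (nxt x) z}" using early_above[OF x] finite_subset by fastforce
    then show ?thesis using below_Field[OF nxt(1)[OF x]] by (simp add: early_def late_def)
  qed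
  have limits_early: "limits \<alpha> \<subseteq> early" by (auto simp: limits_def early_def)
  have iter_early: "(nxt ^^ i) l \<in> early" if "l \<in> limits \<alpha>" for i l
    by (induction i) (use that limits_early nxt_early in auto)
  have iter_mono: "below \<alpha> ((nxt ^^ i) l) ((nxt ^^ j) l)" if l: "l \<in> limits \<alpha>" and "i < j" for i j l
    using \<open>i < j\<close>
  proof (induction j)
    case (Suc j)
    have step: "below \<alpha> ((nxt ^^ j) l) ((nxt ^^ Suc j) l)"
      using nxt(1)[OF iter_early[OF l]] by simp
    show ?case
    proof (cases "i = j")
      case True
      then show ?thesis using step by simp
    next
      case False
      then have "below \<alpha> ((nxt ^^ i) l) ((nxt ^^ j) l)" using Suc by simp
      then show ?thesis using step by (rule below_trans[OF \<alpha>])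
    qed
  qed simp
  have iter_limit: "below \<alpha> ((nxt ^^ i) l) l'" if l: "l \<in> limits \<alpha>" "l' \<in> limits \<alpha>" "below \<alpha> l l'" for i l l'
  proof (induction i)
    case (Suc i)
    then obtain z where "below \<alpha> ((nxt ^^ i) l) z" "below \<alpha> z l'"
      using l(2) unfolding limits_def by blast
    then have "(nxt ((nxt ^^ i) l), z) \<in> \<alpha>" "below \<alpha> z l'" using nxt(2) iter_early l(1) by blast+
    then show ?case using le_below_trans[OF \<alpha>] by simp
  qed (use l in simp)
  have "natLeq_on ?n =o Restr \<alpha> (late \<alpha>)"
  proof -
    have "well_order_on (late \<alpha>) (Restr \<alpha> (late \<alpha>))"
      by (rule well_order_on_Restr[OF \<alpha>]) (auto simp: late_def)
    then have "|late \<alpha>| =o Restr \<alpha> (late \<alpha>)"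
      using finite_well_order_on_ordIso[OF finite_late[OF \<alpha>]] card_of_well_order_on by blast
    then show ?thesis
      using finite_imp_card_of_natLeq_on[OF finite_late[OF \<alpha>]] ordIso_symmetric ordIso_transitive by blast
  qed
  then obtain e where e: "bij_betw e (Field (natLeq_on ?n)) (Field (Restr \<alpha> (late \<alpha>)))"
    and e_less: "\<forall>i\<in>Field (natLeq_on ?n). \<forall>j\<in>Field (natLeq_on ?n).
      below (Restr \<alpha> (late \<alpha>)) (e i) (e j) \<longleftrightarrow> below (natLeq_on ?n) i j"
    using ordIso_bij by blast
  have lateF: "Field (Restr \<alpha> (late \<alpha>)) = late \<alpha>"
    by (rule Field_Restr_Well_order[OF \<alpha>]) (auto simp: late_def)
  have e_in: "e k \<in> late \<alpha>" if "k < ?n" for k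
    using e that lateF Field_natLeq_on[of ?n] by (auto simp: bij_betw_def)
  define G where "G = (\<lambda>x. case x of Inl (i, l) \<Rightarrow> (nxt ^^ i) l | Inr k \<Rightarrow> e k)"
  have G_in: "G x \<in> Field \<alpha>" if "x \<in> Field ?\<sigma>" for x
    using that iter_early e_in unfolding F G_def by (auto simp: early_def late_def)
  have early_late: "below \<alpha> x y" if x: "x \<in> early" and y: "y \<in> late \<alpha>" for x y
  proof (rule ccontr)
    assume "\<not> below \<alpha> x y"
    then have "(y, x) \<in> \<alpha>" using not_below_iff[OF \<alpha>] x y by (auto simp: early_def late_def)
    then have "{z. below \<alpha> x z} \<subseteq> {z. below \<alpha> y z}" using le_below_trans[OF \<alpha>] by blast
    then show False using early_above[OF x] y finite_subset by (auto simp: late_def)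
  qed
  have G_mono: "below \<alpha> (G x) (G y)" if xy: "below ?\<sigma> x y" for x y
  proof (cases x)
    case (Inl a)
    obtain i l where a: "a = (i, l)" by (cases a)
    have l: "l \<in> limits \<alpha>" using below_Field[OF xy] unfolding F Inl a by auto
    show ?thesis
    proof (cases y)
      case y: (Inl a')
      obtain j l' where a': "a' = (j, l')" by (cases a')
      have l': "l' \<in> limits \<alpha>" using below_Field[OF xy] unfolding F y a' by auto
      have "below \<alpha> l l' \<or> l = l' \<and> i < j"
        using xy unfolding Inl y a a' by (auto simp: less P.below_pos below_Restr)
      then show ?thesis
      proof
        assume "below \<alpha> l l'"
        then have "below \<alpha> ((nxt ^^ i) l) l'" by (rule iter_limit[OF l l'])
        moreover have "(l', (nxt ^^ j) l') \<in> \<alpha>"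
          using iter_mono[OF l', of 0 j] wo_refl[OF \<alpha>] l' by (cases "j = 0") (auto simp: below_def limits_def)
        ultimately show ?thesis using below_le_trans[OF \<alpha>] by (simp add: G_def Inl y a a')
      next
        assume "l = l' \<and> i < j"
        then show ?thesis using iter_mono[OF l, of i j] by (simp add: G_def Inl y a a')
      qed
    next
      case (Inr k)
      then have "k < ?n" using below_Field[OF xy] unfolding F by auto
      then show ?thesis
        using early_late[OF iter_early[OF l] e_in] by (simp add: G_def \<open>x = Inl a\<close> a Inr)
    qed
  next
    case (Inr k)
    then obtain k' where y: "y = Inr k'" using xy by (cases y) (auto simp: less)
    have kk': "k < k'" "k' < ?n" using xy unfolding Inr y by (auto simp: less below_natLeq_on)
    then have "k \<in> Field (natLeq_on ?n)" "k' \<in> Field (natLeq_on ?n)"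
      unfolding Field_natLeq_on by auto
    then have "below (Restr \<alpha> (late \<alpha>)) (e k) (e k')"
      using e_less kk' by (auto simp only: below_natLeq_on)
    then show ?thesis by (simp add: below_Restr G_def Inr y)
  qed
  have G_surj: "x \<in> Field \<alpha> \<Longrightarrow> x \<in> G ` Field ?\<sigma>" for x
  proof (induction x rule: below_induct[OF \<alpha>])
    case (1 x)
    show ?case
    proof (cases "x \<in> late \<alpha>")
      case True
      moreover have "e ` {k. k < ?n} = late \<alpha>"
        using e lateF Field_natLeq_on[of ?n] by (simp add: bij_betw_def)
      ultimately obtain k where "k < ?n" "x = e k" by blast
      then have "x = G (Inr k)" "Inr k \<in> Field ?\<sigma>" unfolding F by (auto simp: G_def)
      then show ?thesis by blast
    next
      case False
      then have x: "x \<in> early" using 1(2) by (simp add: early_def)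
      show ?thesis
      proof (cases "x \<in> limits \<alpha>")
        case True
        then have "x = G (Inl (0, x))" "Inl (0, x) \<in> Field ?\<sigma>" unfolding F by (auto simp: G_def)
        then show ?thesis by blast
      next
        case False
        then obtain y where yx: "below \<alpha> y x" and gap: "\<And>z. below \<alpha> y z \<Longrightarrow> \<not> below \<alpha> z x"
          using x unfolding limits_def early_def by blast
        have y: "y \<in> early" by (rule early_down[OF yx x])
        have "\<not> below \<alpha> (nxt y) x" by (rule gap[OF nxt(1)[OF y]])
        then have xn: "x = nxt y" using nxt(2)[OF y yx] by (simp add: below_def)
        obtain q where q: "q \<in> Field ?\<sigma>" "y = G q" using 1(1)[OF yx] below_Field[OF yx] by blast
        have "q \<notin> Inr ` {x. x < ?n}" using q e_in y by (auto simp: G_def early_def)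
        then obtain i l where il: "q = Inl (i, l)" "l \<in> limits \<alpha>" using q(1) unfolding F by auto
        then have "x = G (Inl (Suc i, l))" "Inl (Suc i, l) \<in> Field ?\<sigma>"
          using xn q(2) unfolding F by (auto simp: G_def)
        then show ?thesis by blast
      qed
    qed
  qed
  have "inj_on G (Field ?\<sigma>)"
  proof (rule inj_onI)
    fix x y assume "x \<in> Field ?\<sigma>" "y \<in> Field ?\<sigma>" "G x = G y"
    then show "x = y"
      using below_total[of ?\<sigma> x y] sum G_mono[of x y] G_mono[of y x] by auto
  qed
  then have "bij_betw G (Field ?\<sigma>) (Field \<alpha>)"
    using G_in G_surj by (auto simp: bij_betw_def)
  then have "?\<sigma> =o \<alpha>"
    by (rule strict_bij_imp_ordIso[OF conjunct2[OF sum] \<alpha> _ G_mono])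
  then show ?thesis using ordIso_symmetric unfolding P.pos_def by blast
qed

section \<open>The ordinals \<open>\<zeta>\<^sub>\<alpha>\<close>\<close>

text \<open>The competing upper bounds live on sets, so \<open>\<tau>\<close> is compared through its copy on singletons.\<close>

lemma is_ord_Sup_of_greatest:
  fixes T :: "'a rel set" and \<zeta> :: "'a set rel"
  assumes sup: "is_ord_Sup T \<zeta>" and \<tau>: "\<tau> \<in> T" "Well_order \<tau>" and greatest: "\<And>\<rho>. \<rho> \<in> T \<Longrightarrow> \<rho> \<le>o \<tau>"
  shows "\<zeta> =o \<tau>"
proof -
  let ?\<delta> = "dir_image \<tau> (\<lambda>x. {x})"
  have copy: "\<tau> =o ?\<delta>" by (rule dir_image_ordIso[OF \<tau>(2)]) simp
  have "\<rho> \<le>o ?\<delta>" if "\<rho> \<in> T" for \<rho>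
    using greatest[OF that] copy ordLeq_ordIso_trans by blast
  moreover have "Well_order ?\<delta>" using copy ordIso_Well_order_simp by blast
  ultimately have "\<zeta> \<le>o ?\<delta>" using sup by (simp add: is_ord_Sup_def)
  then have "\<zeta> \<le>o \<tau>" using copy ordIso_symmetric ordLeq_ordIso_trans by blast
  moreover have "\<tau> \<le>o \<zeta>" using sup \<tau> by (simp add: is_ord_Sup_def)
  ultimately show ?thesis by (simp add: ordIso_iff_ordLeq)
qed

lemma zeta_power_times:
  fixes \<alpha> :: "'a rel" and \<beta> :: "'b rel"
  assumes \<alpha>: "Well_order \<alpha>" "infinite (Field \<alpha>)"
    and \<beta>: "Well_order \<beta>" and iso: "\<alpha> =o (natLeq *o \<beta>) +o natLeq_on n"
  shows "zeta \<alpha> =o (natLeq ^o \<beta>) *o natLeq_on (n + 1) \<and> zeta_realized \<alpha>"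
proof -
  let ?\<theta> = "(natLeq ^o \<beta>) *o natLeq_on (n + 1)"
  have types: "Well_order \<tau> \<and> \<tau> \<le>o ?\<theta>" if \<tau>_in: "\<tau> \<in> traversal_types \<alpha>" for \<tau>
  proof -
    obtain V E r where \<tau>: "\<tau> = traversal V E r" and graph: "wellordered_connected_graph V E r"
      and r: "r =o \<alpha>" using \<tau>_in by (auto simp: traversal_types_def)
    have "Field r = V"
      using graph well_order_on_Field wellordered_connected_graph.wellordered by blast
    then have "infinite V"
      using card_of_cong[OF r] card_of_ordIso_finite \<alpha>(2) by blast
    then interpret infinite_search V E r
      using graph by (simp add: infinite_search_def infinite_search_axioms_def)
    show ?thesis
      using T_wo traversal_ordLeq[OF \<beta> ordIso_transitive[OF r iso]] \<tau> by blast
  qed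
  interpret P: power_placement \<beta> n by unfold_locales (rule \<beta>)
  obtain E where graph: "wellordered_connected_graph (Field \<alpha>) E \<alpha>"
    and long: "?\<theta> \<le>o traversal (Field \<alpha>) E \<alpha>"
    using P.long_traversal_exists[OF \<alpha> iso] by blast
  let ?\<tau> = "traversal (Field \<alpha>) E \<alpha>"
  have in_types: "?\<tau> \<in> traversal_types \<alpha>"
    using graph ordIso_reflexive[OF \<alpha>(1)] by (auto simp: traversal_types_def)
  have "\<exists>\<zeta> :: 'a set rel. is_ord_Sup (traversal_types \<alpha>) \<zeta>"
    using types by (intro ord_Sup_exists) blast
  then have "is_ord_Sup (traversal_types \<alpha>) (zeta \<alpha>)"
    unfolding zeta_def by (rule someI_ex)
  then have zeta: "zeta \<alpha> =o ?\<tau>"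
    using is_ord_Sup_of_greatest[OF _ in_types] types in_types long ordLeq_transitive by blast
  moreover have "?\<tau> =o ?\<theta>"
    using types[OF in_types] long by (simp add: ordIso_iff_ordLeq)
  ultimately show ?thesis
    using in_types ordIso_transitive ordIso_symmetric unfolding zeta_realized_def by blast
qed

theorem theorem3p10:
  fixes \<alpha> :: "'a rel"
  assumes "Well_order \<alpha>" and "infinite (Field \<alpha>)"
  shows "(\<exists>(\<beta> :: 'a rel) n. Well_order \<beta> \<and> \<alpha> =o (natLeq *o \<beta>) +o natLeq_on n)
    \<and> (\<forall>(\<beta> :: 'b rel) n (\<beta>' :: 'c rel) n'.
          Well_order \<beta> \<and> \<alpha> =o (natLeq *o \<beta>) +o natLeq_on n \<and>
          Well_order \<beta>' \<and> \<alpha> =o (natLeq *o \<beta>') +o natLeq_on n'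
          \<longrightarrow> \<beta> =o \<beta>' \<and> n = n')
    \<and> (\<forall>(\<beta> :: 'b rel) n.
          Well_order \<beta> \<and> \<alpha> =o (natLeq *o \<beta>) +o natLeq_on n
          \<longrightarrow> zeta \<alpha> =o (natLeq ^o \<beta>) *o natLeq_on (n + 1) \<and> zeta_realized \<alpha>)"
proof (intro conjI allI impI)
  show "\<exists>(\<beta> :: 'a rel) n. Well_order \<beta> \<and> \<alpha> =o (natLeq *o \<beta>) +o natLeq_on n"
    using decomposition_exists Well_order_Restr assms(1) by blast
next
  fix \<beta> :: "'b rel" and n and \<beta>' :: "'c rel" and n'
  assume "Well_order \<beta> \<and> \<alpha> =o (natLeq *o \<beta>) +o natLeq_on n \<and>
    Well_order \<beta>' \<and> \<alpha> =o (natLeq *o \<beta>') +o natLeq_on n'"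
  then have "n = card (late \<alpha>)" "\<beta> =o Restr \<alpha> (limits \<alpha>)"
    and "n' = card (late \<alpha>)" "\<beta>' =o Restr \<alpha> (limits \<alpha>)"
    using decomposition_invariants by blast+
  then show "\<beta> =o \<beta>'" "n = n'"
    using ordIso_symmetric ordIso_transitive by blast+
next
  fix \<beta> :: "'b rel" and n
  assume "Well_order \<beta> \<and> \<alpha> =o (natLeq *o \<beta>) +o natLeq_on n"
  then show "zeta \<alpha> =o (natLeq ^o \<beta>) *o natLeq_on (n + 1)" "zeta_realized \<alpha>"
    using zeta_power_times[OF assms] by blast+
qed

end
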